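(* Suppose $\nabla f$ is Lipschitz continuous with constant $L_f>0$; $h$ is proper, closed and convex; $F=f+h$ is bounded below; there is a constant $\kappa_{\mathrm{eg}}>0$ with $\|g_k-\nabla f(x_k)\|\le \kappa_{\mathrm{eg}}\Delta_k$ for all $k$; there are constants $\bar\kappa\ge\underline\kappa>0$ with $\underline\kappa I\preceq H_k\preceq\bar\kappa I$ for all $k$; $f$ is convex and $F$ is strongly convex with modulus $m>0$. Let $x^\star$ be the unique minimizer of $F$, let $$\underline t:=\beta\min\Big\{1,\frac{\underline\kappa\gamma(1-2c_1)}{L_f},\frac{2\underline\kappa\gamma n c_2}{\kappa_{\mathrm{eg}}^2}\Big\},\quad \tilde\tau:=1-\frac{c_1\underline t\,\underline\kappa\gamma}{4\underline\kappa\gamma+\frac{16\bar\kappa^2}{m}+2L_f}\in(0,1),\quad \tilde\varpi:=\frac{c_1\underline t\,\underline\kappa\gamma(1/L_f+8/m)}{4\underline\kappa\gamma+\frac{16\bar\kappa^2}{m}+2L_f}>0.$$ Then for any $\epsilon>0$, the algorithm ZOPN (described in the context) satisfies the following. (i) If $$\Delta_k\equiv\Delta\le\sqrt{\frac{(1-\tilde\tau)\epsilon}{2(nc_2+\tilde\varpi\kappa_{\mathrm{eg}}^2)}},$$ then the number of iterations required for ZOPN to obtain an $\epsilon$-optimal solution in terms of objective values (i.e., $F(x_k)-F(x^\star)\le\epsilon$) is at most $$\tilde{\mathcal{K}}_1(\epsilon)=\left\lceil\log_{\tilde\tau}\left(\frac{\epsilon}{2(F(x_0)-F(x^\star))}\right)\right\rceil.$$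 (ii) If $\sum_{k=0}^\infty\Delta_k^2\tilde\tau^{-k}=S_2/n<\infty$, then ZOPN obtains an $\epsilon$-optimal solution in terms of objective values within at most $$\tilde{\mathcal{K}}_2(\epsilon)=\left\lceil\log_{\tilde\tau}\left(\frac{\epsilon}{F(x_0)-F(x^\star)+(c_2+\tilde\varpi\kappa_{\mathrm{eg}}^2/n)S_2/\tilde\tau}\right)\right\rceil$$ iterations. (iii) If the number $\varsigma_g$ of function evaluations used per gradient estimate satisfies $\varsigma_g=\mathcal{O}(n)$ and the average number $\varsigma_H$ of function evaluations per iteration used for the Hessian approximation satisfies $\varsigma_H=\mathcal{O}(n)$, then, with sampling radii chosen as in (i) or (ii), ZOPN requires at most $\mathcal{O}(n\log(1/\epsilon))$ function evaluations to produce an $\epsilon$-optimal solution.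
   Context: Setting: $n\ge1$, $F=f+h$ with $f:\mathbb{R}^n\to\mathbb{R}$ continuously differentiable and $h:\mathbb{R}^n\to\mathbb{R}\cup\{+\infty\}$. $\|\cdot\|$ is the Euclidean (spectral) norm, $\|x\|_A=\sqrt{x^\top A x}$ for symmetric positive definite $A$, and $\partial F(x)=\nabla f(x)+\partial h(x)$. $F$ strongly convex with modulus $m$ means $F(x)\ge F(y)+q^\top(x-y)+\frac m2\|x-y\|^2$ for all $x,y$ and all $q\in\partial F(y)$. Algorithm ZOPN. Parameters: $x_0\in\mathrm{dom}\,F$, $c_1\in(0,1/2)$, $c_2>0$, $\beta\in(0,1)$, $\gamma\in(0,1]$, initial step size $\bar t>0$ with $\bar t\ge\underline t$. For $k=0,1,2,\dots$: choose a sampling radius $\Delta_k>0$; compute from function values an approximate gradient $g_k\in\mathbb{R}^n$ of $f$ at $x_k$ and a symmetric positive definite approximate Hessian $H_k$; find $d_k\in\mathbb{R}^n$ (an inexact minimizer of $g_k^\top d+\frac12 d^\top H_kd+h(x_k+d)$) for which there exists $r_k\in g_k+H_kd_k+\partial h(x_k+d_k)$ with $\|r_k\|_{H_k^{-1}}\le(1-\gamma)\|d_k\|_{H_k}$; with $\Phi_k:=g_k^\top d_k+h(x_k+d_k)-h(x_k)$, let $t_k=\bar t\beta^{i}$ where $i\ge0$ is the smallest integer such that $F(x_k+t_kd_k)-F(x_k)\le c_1t_k\Phi_k+nc_2\Delta_k^2$ (backtracking; each trial costs one function evaluation); set $x_{k+1}=x_k+t_kd_k$. The iteration is run without a stopping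 test. It is understood in (i) that $F(x_0)>F(x^\star)$ so that the logarithm is defined, and negative values of the iteration bounds are read as $0$. "Within at most $K$ iterations" means that $F(x_k)-F(x^\star)\le\epsilon$ for some $k\le K$. Average number of function evaluations per iteration: if $C_T$ is the total number of function evaluations used (here, by the Hessian approximation scheme, whose evaluation schedule does not depend on $\epsilon$) over the first $T$ iterations and $\lim_{T\to\infty}C_T/T$ exists, the average is this limit. The $\mathcal{O}(n\log(1/\epsilon))$ bound is asymptotic as $\epsilon\to0$, with an implied constant depending only on $\tilde\tau$, $\beta$, $\bar t$, $\underline t$ and the constants in $\varsigma_g=\mathcal{O}(n)$, $\varsigma_H=\mathcal{O}(n)$ (with $S_2$ and the problem data regarded as fixed). *)

theory Defs
  imports "HOL-Analysis.Analysis"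
begin

section \<open>Extended-valued convex functions\<close>

text \<open>A function into the reals extended by plus infinity is a function into \<^typ>\<open>ereal\<close>
  that omits minus infinity; this is part of \<open>proper\<close>.\<close>

definition proper :: "('a \<Rightarrow> ereal) \<Rightarrow> bool" where
  "proper h \<longleftrightarrow> (\<forall>x. h x \<noteq> -\<infinity>) \<and> (\<exists>x. h x \<noteq> \<infinity>)"

definition epi :: "('a \<Rightarrow> ereal) \<Rightarrow> ('a \<times> real) set" where
  "epi h = {(x, r). h x \<le> ereal r}"

definition closed_fun :: "('a::topological_space \<Rightarrow> ereal) \<Rightarrow> bool" where
  "closed_fun h \<longleftrightarrow> closed (epi h)"

definition convex_fun :: "('a::real_vector \<Rightarrow> ereal) \<Rightarrow> bool" where
  "convex_fun h \<longleftrightarrow> convex (epi h)"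

definition effdom :: "('a \<Rightarrow> ereal) \<Rightarrow> 'a set" where
  "effdom h = {x. h x < \<infinity>}"

text \<open>The convex subdifferential; it is empty outside the effective domain.\<close>

definition subdiff :: "('a::real_inner \<Rightarrow> ereal) \<Rightarrow> 'a \<Rightarrow> 'a set" where
  "subdiff h x = {v. x \<in> effdom h \<and> (\<forall>y. h x + ereal (v \<bullet> (y - x)) \<le> h y)}"

section \<open>The composite objective\<close>

definition objective :: "('a \<Rightarrow> real) \<Rightarrow> ('a \<Rightarrow> ereal) \<Rightarrow> 'a \<Rightarrow> ereal" where
  "objective f h x = ereal (f x) + h x"

definition subdiff_objective ::
    "('a::real_inner \<Rightarrow> 'a) \<Rightarrow> ('a \<Rightarrow> ereal) \<Rightarrow> 'a \<Rightarrow> 'a set" where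
  "subdiff_objective gradf h x = {gradf x + v | v. v \<in> subdiff h x}"

definition strongly_convex_objective ::
    "('a::real_inner \<Rightarrow> real) \<Rightarrow> ('a \<Rightarrow> 'a) \<Rightarrow> ('a \<Rightarrow> ereal) \<Rightarrow> real \<Rightarrow> bool" where
  "strongly_convex_objective f gradf h m \<longleftrightarrow>
     (\<forall>x y. \<forall>q \<in> subdiff_objective gradf h y.
        objective f h y + ereal (q \<bullet> (x - y) + m / 2 * (norm (x - y))\<^sup>2) \<le> objective f h x)"

section \<open>Symmetric matrices\<close>

definition pos_def :: "real^'n^'n \<Rightarrow> bool" where
  "pos_def A \<longleftrightarrow> transpose A = A \<and> (\<forall>v. v \<noteq> 0 \<longrightarrow> 0 < v \<bullet> (A *v v))"

definition pos_semidef :: "real^'n^'n \<Rightarrow> bool" where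
  "pos_semidef A \<longleftrightarrow> transpose A = A \<and> (\<forall>v. 0 \<le> v \<bullet> (A *v v))"

definition loewner_le :: "real^'n^'n \<Rightarrow> real^'n^'n \<Rightarrow> bool" where
  "loewner_le A B \<longleftrightarrow> pos_semidef (B - A)"

definition mnorm :: "real^'n^'n \<Rightarrow> real^'n \<Rightarrow> real" where
  "mnorm A x = sqrt (x \<bullet> (A *v x))"

section \<open>The algorithm\<close>

text \<open>A run is the whole infinite sequence of data produced without a stopping test.
  The step size of iteration \<open>k\<close> is the initial one times \<open>\<beta> ^ backtracks R k\<close>.\<close>

record 'n zopn =
  radius :: "nat \<Rightarrow> real"
  gradient_est :: "nat \<Rightarrow> real^'n"
  hessian_est :: "nat \<Rightarrow> real^'n^'n"
  direction :: "nat \<Rightarrow> real^'n"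
  backtracks :: "nat \<Rightarrow> nat"
  iterate :: "nat \<Rightarrow> real^'n"

definition inexact_direction ::
    "(real^'n \<Rightarrow> ereal) \<Rightarrow> real \<Rightarrow> real^'n \<Rightarrow> real^'n \<Rightarrow> real^'n^'n \<Rightarrow> real^'n \<Rightarrow> bool" where
  "inexact_direction h \<gamma> x g H d \<longleftrightarrow>
     (\<exists>r. r \<in> {g + H *v d + v | v. v \<in> subdiff h (x + d)} \<and>
          mnorm (matrix_inv H) r \<le> (1 - \<gamma>) * mnorm H d)"

definition predicted_decrease ::
    "(real^'n \<Rightarrow> ereal) \<Rightarrow> real^'n \<Rightarrow> real^'n \<Rightarrow> real^'n \<Rightarrow> ereal" where
  "predicted_decrease h x g d = ereal (g \<bullet> d) + h (x + d) - h x"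

definition sufficient_decrease ::
    "(real^'n \<Rightarrow> real) \<Rightarrow> (real^'n \<Rightarrow> ereal) \<Rightarrow> real \<Rightarrow> real \<Rightarrow> real \<Rightarrow>
     real^'n \<Rightarrow> real^'n \<Rightarrow> real^'n \<Rightarrow> real \<Rightarrow> bool" where
  "sufficient_decrease f h c1 c2 \<Delta> x g d t \<longleftrightarrow>
     objective f h (x + t *\<^sub>R d) - objective f h x
       \<le> ereal (c1 * t) * predicted_decrease h x g d + ereal (real CARD('n) * c2 * \<Delta>\<^sup>2)"

definition zopn_run ::
    "(real^'n \<Rightarrow> real) \<Rightarrow> (real^'n \<Rightarrow> ereal) \<Rightarrow> real \<Rightarrow> real \<Rightarrow> real \<Rightarrow> real \<Rightarrow> real \<Rightarrow>
     real^'n \<Rightarrow> 'n zopn \<Rightarrow> bool" where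
  "zopn_run f h c1 c2 \<beta> \<gamma> tbar x0 R \<longleftrightarrow>
     iterate R 0 = x0 \<and>
     (\<forall>k. radius R k > 0 \<and>
          pos_def (hessian_est R k) \<and>
          inexact_direction h \<gamma> (iterate R k) (gradient_est R k) (hessian_est R k) (direction R k) \<and>
          (let accept = (\<lambda>i. sufficient_decrease f h c1 c2 (radius R k) (iterate R k)
                               (gradient_est R k) (direction R k) (tbar * \<beta> ^ i))
           in accept (backtracks R k) \<and> (\<forall>i < backtracks R k. \<not> accept i)) \<and>
          iterate R (Suc k) = iterate R k + (tbar * \<beta> ^ backtracks R k) *\<^sub>R direction R k)"

definition estimate_bounds ::
    "(real^'n \<Rightarrow> real^'n) \<Rightarrow> real \<Rightarrow> real \<Rightarrow> real \<Rightarrow> 'n zopn \<Rightarrow> bool" where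
  "estimate_bounds gradf \<kappa>eg \<kappa>l \<kappa>u R \<longleftrightarrow>
     (\<forall>k. norm (gradient_est R k - gradf (iterate R k)) \<le> \<kappa>eg * radius R k \<and>
          loewner_le (mat \<kappa>l) (hessian_est R k) \<and>
          loewner_le (hessian_est R k) (mat \<kappa>u))"

section \<open>Function evaluations\<close>

text \<open>The cost of the first \<open>K\<close> iterations: \<open>sg\<close> evaluations for each gradient estimate,
  \<open>hs k\<close> for the Hessian approximation in iteration \<open>k\<close>, and one for each trial of the line
  search (the accepted one included). The value at the current iterate is known from the
  previous accepted trial, so only \<open>F x\<^sub>0\<close> has to be paid for in addition.\<close>

definition zopn_evals :: "nat \<Rightarrow> (nat \<Rightarrow> nat) \<Rightarrow> ('n::finite) zopn \<Rightarrow> nat \<Rightarrow> nat" where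
  "zopn_evals sg hs R K = 1 + (\<Sum>k<K. sg + hs k + (backtracks R k + 1))"

text \<open>The constant in the bound on the number of function evaluations, where the cost of a
  gradient estimate is at most \<open>cg * n\<close> and the average cost of the Hessian approximation is
  at most \<open>cH * n\<close>. The dimension \<open>n\<close> is the cardinality of a type, over which HOL cannot
  quantify inside a formula; a constant bound by an existential quantifier could therefore
  depend on \<open>n\<close>. An explicit one that does not mention that type cannot. Here
  \<open>log \<beta> (tlow / tbar)\<close> bounds the number of rejected trials in one line search, and
  \<open>ln (1 / \<epsilon>) / ln (1 / \<tau>)\<close> is the leading term of the number of iterations; the factor 2
  and the summand 3 absorb the lower-order terms.\<close>

definition zopn_eval_const :: "real \<Rightarrow> real \<Rightarrow> real \<Rightarrow> real \<Rightarrow> real \<Rightarrow> real \<Rightarrow> real" where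
  "zopn_eval_const \<tau> \<beta> tbar tlow cg cH =
     2 * (cg + cH + 3 + log \<beta> (tlow / tbar)) / ln (1 / \<tau>)"

end

theory Submission
  imports Defs
begin

text \<open>
  Write \<open>\<Phi>\<close> for the predicted decrease along the direction \<open>d\<close> at the iterate \<open>x\<close>, \<open>G\<close> for the
  gap between \<open>F x\<close> and the minimum of \<open>F\<close>, and \<open>\<Delta>\<close> for the sampling radius. Everything follows
  from the one-step recursion that bounds the next gap by \<open>\<tau> G + (n c2 + \<omega> \<kappa>eg\<^sup>2) \<Delta>\<^sup>2\<close>
  (lemma \<open>zopn_step\<close>). It has three ingredients.

  The subgradient inequality of \<open>h\<close> at \<open>x + d\<close> and the inexactness criterion give
  \<open>\<Phi> \<le> - \<gamma> (mnorm H d)\<^sup>2 \<le> - \<gamma> \<kappa>l |d|\<^sup>2\<close> (\<open>model_decrease\<close>). With the descent lemma for \<open>f\<close>, and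
  with the gradient error split off by Young's inequality, this shows that the line search accepts
  every step size up to \<open>tlow / \<beta>\<close> (\<open>line_search_accepts\<close>), so that no accepted step size
  is below \<open>tlow\<close>.

  Convexity of \<open>f\<close>, compared between \<open>x\<close> and the minimizer, and the same subgradient of \<open>h\<close>,
  compared between \<open>x + d\<close> and the minimizer, bound \<open>G\<close> by \<open>- \<Phi>\<close> plus terms that are linear in the
  distance from \<open>x\<close> to the minimizer. Strong convexity bounds the square of this distance by
  \<open>2 G / m\<close>, and Young's inequality absorbs these terms into \<open>G / 2\<close> (\<open>gap_le_model_decrease\<close>).
  Hence \<open>- \<Phi>\<close> is at least a fixed multiple of \<open>G\<close>, up to an error of order \<open>\<Delta>\<^sup>2\<close>, and the
  sufficient decrease condition turns this into the recursion.

  Strong convexity is stated through subgradients, so the existence of a minimizer needs a point at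
  which \<open>h\<close> has one. Such a point is a minimizer of \<open>h\<close> plus a suitable quadratic: boundedness of
  \<open>F\<close> from below and the descent lemma make this sum coercive. Strong convexity at that point makes
  \<open>F\<close> itself coercive (\<open>strongly_convex_minimizer\<close>).

  The iteration bounds come from unrolling the recursion. For the number of function evaluations,
  the number \<open>K\<close> of iterations is chosen as a function of \<open>\<epsilon>\<close> only, uniformly in the run
  (\<open>eventually_evals_le\<close>).
\<close>

section \<open>Smooth and convex functions\<close>

lemma difference_quotient_at_right:
  fixes g :: "'a::real_inner \<Rightarrow> real"
  assumes "GDERIV g p :> v"
  shows "((\<lambda>t. (g (p + t *\<^sub>R w) - g p) / t) \<longlongrightarrow> w \<bullet> v) (at_right 0)"
proof -
  have g: "(g has_derivative (\<lambda>u. u \<bullet> v)) (at (p + 0 *\<^sub>R w))"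
    using assms by (simp add: gderiv_def)
  have "((\<lambda>t. p + t *\<^sub>R w) has_derivative (\<lambda>t. t *\<^sub>R w)) (at 0)"
    by (auto intro!: derivative_eq_intros)
  from has_derivative_compose[OF this g]
  have "((\<lambda>t. g (p + t *\<^sub>R w)) has_real_derivative w \<bullet> v) (at 0)"
    by (simp add: has_field_derivative_def mult_commute_abs)
  then have "((\<lambda>t. (g (p + t *\<^sub>R w) - g p) / t) \<longlongrightarrow> w \<bullet> v) (at 0)"
    by (simp add: DERIV_def)
  then show ?thesis
    by (rule filterlim_mono) (auto simp: at_le)
qed

lemma convex_gradient_inequality:
  fixes f :: "'a::real_inner \<Rightarrow> real"
  assumes cvx: "convex_on UNIV f" and grad: "GDERIV f x :> v"
  shows "f x + v \<bullet> (y - x) \<le> f y"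
proof -
  have "\<forall>\<^sub>F t in at_right 0. (f (x + t *\<^sub>R (y - x)) - f x) / t \<le> f y - f x"
    unfolding eventually_at_right_field
  proof (intro exI[of _ 1] conjI allI impI)
    fix t :: real assume t: "0 < t" "t < 1"
    have "x + t *\<^sub>R (y - x) = (1 - t) *\<^sub>R x + t *\<^sub>R y"
      by (simp add: algebra_simps)
    then have "f (x + t *\<^sub>R (y - x)) \<le> (1 - t) * f x + t * f y"
      using convex_onD[OF cvx, of t x y] t by simp
    then show "(f (x + t *\<^sub>R (y - x)) - f x) / t \<le> f y - f x"
      using t by (simp add: field_simps)
  qed simp
  from tendsto_upperbound[OF difference_quotient_at_right[OF grad] this]
  show ?thesis by (simp add: inner_commute)
qed

lemma descent_lemma:
  fixes f :: "'a::real_inner \<Rightarrow> real"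
  assumes grad: "\<And>x. GDERIV f x :> gradf x" and lip: "L-lipschitz_on UNIV gradf"
  shows "f (x + w) \<le> f x + gradf x \<bullet> w + L / 2 * (norm w)\<^sup>2"
proof -
  define \<phi> where "\<phi> t = f (x + t *\<^sub>R w) - t * (gradf x \<bullet> w) - L / 2 * t\<^sup>2 * (norm w)\<^sup>2" for t
  define \<phi>' where "\<phi>' t = gradf (x + t *\<^sub>R w) \<bullet> w - gradf x \<bullet> w - L * t * (norm w)\<^sup>2" for t
  have f: "((\<lambda>t. f (x + t *\<^sub>R w)) has_real_derivative gradf (x + t *\<^sub>R w) \<bullet> w) (at t)" for t
  proof -
    have "((\<lambda>t. x + t *\<^sub>R w) has_derivative (\<lambda>t. t *\<^sub>R w)) (at t)"
      by (auto intro!: derivative_eq_intros)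
    from has_derivative_compose[OF this grad[unfolded gderiv_def]] show ?thesis
      by (simp add: has_field_derivative_def inner_commute mult_commute_abs)
  qed
  have "\<phi> 1 \<le> \<phi> 0"
  proof (rule DERIV_nonpos_imp_nonincreasing[of 0 1 \<phi>])
    fix t :: real assume t: "0 \<le> t" "t \<le> 1"
    have "DERIV \<phi> t :> \<phi>' t"
      unfolding \<phi>_def \<phi>'_def by (auto intro!: derivative_eq_intros f)
    moreover have "\<phi>' t \<le> 0"
    proof -
      have "gradf (x + t *\<^sub>R w) \<bullet> w - gradf x \<bullet> w \<le> norm (gradf (x + t *\<^sub>R w) - gradf x) * norm w"
        by (metis inner_diff_left norm_cauchy_schwarz)
      also have "\<dots> \<le> L * (t * norm w) * norm w"
        using lipschitz_onD[OF lip, of "x + t *\<^sub>R w" x] t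
        by (intro mult_right_mono) (auto simp: dist_norm)
      finally show ?thesis
        by (simp add: \<phi>'_def power2_eq_square algebra_simps)
    qed
    ultimately show "\<exists>y. DERIV \<phi> t :> y \<and> y \<le> 0" by blast
  qed simp
  then show ?thesis by (simp add: \<phi>_def algebra_simps)
qed

lemma convex_fun_segment:
  assumes "convex_fun h" "h x = ereal a" "h y = ereal b" "0 \<le> t" "t \<le> 1"
  shows "h (x + t *\<^sub>R (y - x)) \<le> ereal (a + t * (b - a))"
proof -
  have "(1 - t) *\<^sub>R (x, a) + t *\<^sub>R (y, b) \<in> epi h"
    using assms by (intro convexD[of "epi h"]) (auto simp: convex_fun_def epi_def)
  then show ?thesis by (simp add: epi_def algebra_simps)
qed

lemma proper_effdomE:
  assumes "proper h" "x \<in> effdom h"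
  obtains a where "h x = ereal a"
  using assms by (cases "h x") (auto simp: proper_def effdom_def)

lemma effdom_objective [simp]: "effdom (objective f h) = effdom h"
  by (auto simp: effdom_def objective_def)

section \<open>Minimizers of the composite objective\<close>

text \<open>First-order optimality for a differentiable function plus a convex one; the
  differentiable summand need not be convex.\<close>

lemma minimizer_stationary:
  assumes h: "proper h" "convex_fun h" and grad: "GDERIV g p :> v" and p: "p \<in> effdom h"
    and min: "\<And>y. objective g h p \<le> objective g h y"
  shows "- v \<in> subdiff h p"
proof -
  obtain a where a: "h p = ereal a" using proper_effdomE[OF h(1) p] .
  have "h p + ereal (- v \<bullet> (y - p)) \<le> h y" for y
  proof (cases "h y")
    case (real b)
    have "\<forall>\<^sub>F t in at_right 0. a - b \<le> (g (p + t *\<^sub>R (y - p)) - g p) / t"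
      unfolding eventually_at_right_field
    proof (intro exI[of _ 1] conjI allI impI)
      fix t :: real assume t: "0 < t" "t < 1"
      have "ereal (g p + a) \<le> ereal (g (p + t *\<^sub>R (y - p))) + h (p + t *\<^sub>R (y - p))"
        using min[of "p + t *\<^sub>R (y - p)"] a by (simp add: objective_def)
      also have "\<dots> \<le> ereal (g (p + t *\<^sub>R (y - p))) + ereal (a + t * (b - a))"
        using convex_fun_segment[OF h(2) a real, of t] t by (intro add_left_mono) auto
      finally show "a - b \<le> (g (p + t *\<^sub>R (y - p)) - g p) / t"
        using t by (simp add: field_simps)
    qed simp
    from tendsto_lowerbound[OF difference_quotient_at_right[OF grad] this]
    show ?thesis using a real by (simp add: inner_commute)
  qed (use h in \<open>auto simp: proper_def\<close>)
  then show ?thesis using p by (simp add: subdiff_def)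
qed

lemma closed_sublevel_objective:
  fixes h :: "'a::topological_space \<Rightarrow> ereal"
  assumes "closed_fun h" "continuous_on UNIV g"
  shows "closed {x. objective g h x \<le> ereal a}"
proof -
  have "objective g h x \<le> ereal a \<longleftrightarrow> (x, a - g x) \<in> epi h" for x
    by (cases "h x") (auto simp: objective_def epi_def)
  then have "{x. objective g h x \<le> ereal a} = (\<lambda>x. (x, a - g x)) -` epi h" by auto
  moreover have "continuous_on UNIV (\<lambda>x. (x, a - g x))"
    using assms(2) by (intro continuous_intros)
  ultimately show ?thesis
    using assms(1) by (simp add: closed_fun_def closed_vimage)
qed

text \<open>The sublevel sets are closed because the epigraph is. The minimum is found in the
  intersection of the compact sublevel sets whose levels decrease to the infimum.\<close>

lemma objective_attains_minimum:
  fixes h :: "'a::euclidean_space \<Rightarrow> ereal"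
  assumes h: "closed_fun h" and g: "continuous_on UNIV g" and x0: "x0 \<in> effdom h"
    and bdd: "bounded {x. objective g h x \<le> objective g h x0}"
    and below: "\<And>x. ereal B \<le> objective g h x"
  obtains p where "p \<in> effdom h" "\<And>x. objective g h p \<le> objective g h x"
proof -
  let ?F = "objective g h"
  define I where "I = Inf (range ?F)"
  have I_le: "I \<le> ?F x" for x by (simp add: I_def Inf_lower)
  have "?F x0 \<noteq> \<infinity>" using x0 by (auto simp: objective_def effdom_def)
  moreover have "ereal B \<le> I" using below by (auto simp: I_def intro: Inf_greatest)
  ultimately obtain c where c: "I = ereal c"
    using I_le[of x0] by (cases I) auto
  have "\<exists>p. ?F p \<le> I"
  proof (cases "?F x0 \<le> I")
    case False
    then have lt: "I < ?F x0" by simp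
    obtain b where b: "?F x0 = ereal b"
      using \<open>?F x0 \<noteq> \<infinity>\<close> below[of x0] by (cases "?F x0") auto
    define s where "s k = c + (b - c) / real (Suc k)" for k
    define S where "S k = {x. ?F x \<le> ereal (s k)}" for k
    have cb: "c < b" using lt b c by simp
    have s_le: "s k \<le> b" for k
    proof -
      have "(b - c) / real (Suc k) \<le> (b - c) / 1" using cb by (intro divide_left_mono) auto
      then show ?thesis by (simp add: s_def)
    qed
    have "compact (S k)" for k
    proof -
      have "S k \<subseteq> {x. ?F x \<le> ?F x0}"
        using s_le[of k] b by (auto simp: S_def intro: order_trans)
      then show ?thesis
        using closed_sublevel_objective[OF h g] bdd
        by (auto simp: compact_eq_bounded_closed S_def intro: bounded_subset)
    qed
    moreover have "S k \<noteq> {}" for k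
    proof -
      have "Inf (range ?F) < ereal (s k)" using cb c by (simp add: I_def[symmetric] s_def)
      then obtain x where "?F x < ereal (s k)" by (auto simp: Inf_less_iff)
      then show ?thesis by (auto simp: S_def intro: less_imp_le)
    qed
    moreover have "S k \<subseteq> S j" if "j \<le> k" for j k
    proof -
      have "s k \<le> s j" using cb that by (auto simp: s_def intro!: divide_left_mono)
      then show ?thesis by (auto simp: S_def intro: order_trans)
    qed
    ultimately have "\<Inter> (range S) \<noteq> {}"
      by (intro compact_nest) auto
    then obtain p where p: "\<And>k. ?F p \<le> ereal (s k)" by (auto simp: S_def)
    have "(\<lambda>k. (b - c) / real (Suc k)) \<longlonglongrightarrow> 0"
      by (intro LIMSEQ_Suc lim_const_over_n)
    then have "s \<longlonglongrightarrow> c" unfolding s_def using tendsto_add[OF tendsto_const[of c]] by fastforce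
    then have "?F p \<le> ereal c"
      by (intro LIMSEQ_le_const[of "\<lambda>k. ereal (s k)"]) (auto simp: p)
    then show ?thesis using c by auto
  qed auto
  then obtain p where p: "?F p \<le> I" by auto
  then have "p \<in> effdom ?F" using c by (auto simp: effdom_def)
  moreover have "?F p \<le> ?F x" for x using p I_le by (rule order_trans)
  ultimately show ?thesis using that by simp
qed

text \<open>Existence of a minimizer, with quadratic growth. The auxiliary function \<open>g\<close> in the
  proof exceeds \<open>f - f 0\<close> by at least half of the quadratic term, so that \<open>g + h\<close> is coercive.
  A minimizer of it supplies the subgradient from which strong convexity can start.\<close>

lemma strongly_convex_minimizer:
  fixes f :: "'a::euclidean_space \<Rightarrow> real"
  assumes grad: "\<And>x. GDERIV f x :> gradf x" and lip: "L-lipschitz_on UNIV gradf" and L: "L > 0"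
    and h: "proper h" "closed_fun h" "convex_fun h"
    and below: "\<And>x. ereal B \<le> objective f h x"
    and strong: "strongly_convex_objective f gradf h m" and m: "m > 0"
  obtains p where "p \<in> effdom h"
    "\<And>x. objective f h p + ereal (m / 2 * (norm (x - p))\<^sup>2) \<le> objective f h x"
proof -
  obtain z where z: "z \<in> effdom h" using h(1) by (auto simp: proper_def effdom_def)
  define g where "g x = gradf 0 \<bullet> x + L * (x \<bullet> x)" for x
  have f_le: "f x \<le> f 0 + gradf 0 \<bullet> x + L / 2 * (norm x)\<^sup>2" for x
    using descent_lemma[OF grad lip, of 0 x] by simp
  have g_grad: "GDERIV g x :> gradf 0 + (2 * L) *\<^sub>R x" for x
    unfolding gderiv_def g_def
    by (auto intro!: derivative_eq_intros simp: algebra_simps inner_commute inner_add_right)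
  have g_below: "ereal (B - f 0 + L / 2 * (norm x)\<^sup>2) \<le> objective g h x" for x
  proof (cases "h x")
    case (real a)
    have "B \<le> f x + a" using below[of x] real by (simp add: objective_def)
    then show ?thesis using f_le[of x] real
      by (simp add: objective_def g_def power2_norm_eq_inner)
  qed (use h in \<open>auto simp: proper_def objective_def\<close>)
  obtain a where a: "h z = ereal a" using proper_effdomE[OF h(1) z] .
  have "bounded {x. objective g h x \<le> objective g h z}"
  proof -
    define b where "b = 2 * (g z + a - B + f 0) / L"
    have "norm x \<le> sqrt b" if "objective g h x \<le> objective g h z" for x
    proof -
      have "B - f 0 + L / 2 * (norm x)\<^sup>2 \<le> g z + a"
        using order_trans[OF g_below that] a by (simp add: objective_def)
      then have "(norm x)\<^sup>2 \<le> b" using L by (simp add: b_def field_simps)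
      then show ?thesis by (simp add: real_le_rsqrt)
    qed
    then show ?thesis by (auto simp: bounded_iff)
  qed
  moreover have "ereal (B - f 0) \<le> objective g h x" for x
    using L by (intro order_trans[OF _ g_below]) simp
  moreover have "continuous_on UNIV g" unfolding g_def by (intro continuous_intros)
  ultimately obtain y where y: "y \<in> effdom h" "\<And>x. objective g h y \<le> objective g h x"
    using objective_attains_minimum[OF h(2) _ z] by metis
  define q where "q = gradf y - (gradf 0 + (2 * L) *\<^sub>R y)"
  have "q \<in> subdiff_objective gradf h y"
    using minimizer_stationary[OF h(1,3) g_grad y]
    by (auto simp: q_def subdiff_objective_def intro!: exI[of _ "- (gradf 0 + (2 * L) *\<^sub>R y)"])
  then have growth: "objective f h y + ereal (q \<bullet> (x - y) + m / 2 * (norm (x - y))\<^sup>2)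
      \<le> objective f h x" for x
    using strong by (auto simp: strongly_convex_objective_def)
  obtain b where b: "h y = ereal b" using proper_effdomE[OF h(1) y(1)] .
  \<comment> \<open>The linear term cannot outweigh the quadratic one outside this ball.\<close>
  have "norm (x - y) \<le> 2 * norm q / m" if "objective f h x \<le> objective f h y" for x
  proof -
    have "q \<bullet> (x - y) + m / 2 * (norm (x - y))\<^sup>2 \<le> 0"
      using order_trans[OF growth that] b by (simp add: objective_def)
    moreover have "- (q \<bullet> (x - y)) \<le> norm q * norm (x - y)"
      using Cauchy_Schwarz_ineq2[of q "x - y"] by linarith
    ultimately have "norm (x - y) * (m * norm (x - y)) \<le> norm (x - y) * (2 * norm q)"
      by (simp add: power2_eq_square algebra_simps)
    then show ?thesis using m
      by (cases "x = y") (auto simp: field_simps mult_le_cancel_left)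
  qed
  then have "bounded {x. objective f h x \<le> objective f h y}"
    by (intro bounded_subset[OF bounded_cball[of y "2 * norm q / m"]])
       (auto simp: dist_norm norm_minus_commute)
  moreover have "continuous_on UNIV f"
    using grad by (auto simp: gderiv_def intro!: has_derivative_continuous_on
        intro: has_derivative_at_withinI)
  ultimately obtain p where p: "p \<in> effdom h" "\<And>x. objective f h p \<le> objective f h x"
    using objective_attains_minimum[OF h(2) _ y(1)] below by metis
  have "0 \<in> subdiff_objective gradf h p"
    using minimizer_stationary[OF h(1,3) grad p]
    by (auto simp: subdiff_objective_def intro!: exI[of _ "- gradf p"])
  then have "objective f h p + ereal (m / 2 * (norm (x - p))\<^sup>2) \<le> objective f h x" for x
    using strong by (force simp: strongly_convex_objective_def)
  then show ?thesis using p(1) that by blast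
qed

section \<open>Positive definite matrices\<close>

lemma mnorm_power2: "pos_def A \<Longrightarrow> (mnorm A x)\<^sup>2 = x \<bullet> (A *v x)"
  by (cases "x = 0") (auto simp: mnorm_def pos_def_def less_imp_le)

lemma mnorm_nonneg: "pos_def A \<Longrightarrow> 0 \<le> mnorm A x"
  by (cases "x = 0") (auto simp: mnorm_def pos_def_def less_imp_le)

lemma pos_def_symmetric: "pos_def A \<Longrightarrow> x \<bullet> (A *v y) = y \<bullet> (A *v x)"
  by (metis dot_lmul_matrix inner_commute pos_def_def vector_transpose_matrix)

lemma pos_def_Cauchy_Schwarz:
  assumes A: "pos_def A"
  shows "\<bar>x \<bullet> (A *v y)\<bar> \<le> mnorm A x * mnorm A y"
proof (cases "y = 0")
  case False
  define a b c where "a = x \<bullet> (A *v x)" and "b = x \<bullet> (A *v y)" and "c = y \<bullet> (A *v y)"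
  have c: "c > 0" using A False by (auto simp: pos_def_def c_def)
  have "0 \<le> (c *\<^sub>R x - b *\<^sub>R y) \<bullet> (A *v (c *\<^sub>R x - b *\<^sub>R y))"
    using mnorm_power2[OF A, of "c *\<^sub>R x - b *\<^sub>R y"] by (metis zero_le_power2)
  also have "\<dots> = c * (a * c - b\<^sup>2)"
    using pos_def_symmetric[OF A, of x y]
    by (simp add: a_def b_def c_def matrix_vector_mult_diff_distrib matrix_vector_mult_scaleR
        inner_diff_left inner_diff_right power2_eq_square algebra_simps)
  finally have "b\<^sup>2 \<le> (mnorm A x * mnorm A y)\<^sup>2"
    using c by (simp add: zero_le_mult_iff power_mult_distrib mnorm_power2[OF A] a_def c_def)
  then show ?thesis
    using mnorm_nonneg[OF A] by (simp add: b_def abs_le_square_iff[symmetric])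
qed (simp add: mnorm_def)

lemma pos_def_inverse:
  assumes A: "pos_def A"
  obtains w where "A *v w = r" "mnorm (matrix_inv A) r = mnorm A w"
proof -
  have "\<forall>x. A *v x = 0 \<longrightarrow> x = 0"
    using A by (metis inner_zero_right less_irrefl pos_def_def)
  then have inv: "invertible A"
    by (simp add: invertible_left_inverse matrix_left_invertible_ker)
  define w where "w = matrix_inv A *v r"
  have "A *v w = r"
    using someI_ex[OF inv[unfolded invertible_def], folded matrix_inv_def]
    by (simp add: w_def matrix_vector_mul_assoc)
  moreover from this have "mnorm (matrix_inv A) r = mnorm A w"
    by (simp add: mnorm_def w_def inner_commute)
  ultimately show ?thesis using that by blast
qed

lemma mat_vector_mult: "mat c *v x = c *\<^sub>R (x :: real^'n)"
proof -
  have "mat c = c *\<^sub>R (mat 1 :: real^'n^'n)" by (simp add: mat_def vec_eq_iff)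
  then show ?thesis by (simp add: scaleR_matrix_vector_assoc[symmetric])
qed

lemma loewner_le_mat_left: "loewner_le (mat c) A \<Longrightarrow> c * (norm x)\<^sup>2 \<le> x \<bullet> (A *v x)"
  by (auto simp: loewner_le_def pos_semidef_def matrix_vector_mult_diff_rdistrib inner_diff_right
      mat_vector_mult power2_norm_eq_inner)

lemma loewner_le_mat_right: "loewner_le A (mat c) \<Longrightarrow> x \<bullet> (A *v x) \<le> c * (norm x)\<^sup>2"
  by (auto simp: loewner_le_def pos_semidef_def matrix_vector_mult_diff_rdistrib inner_diff_right
      mat_vector_mult power2_norm_eq_inner)

lemma mnorm_le:
  assumes "pos_def A" "loewner_le A (mat c)"
  shows "mnorm A x \<le> sqrt c * norm x"
  using loewner_le_mat_right[OF assms(2), of x]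
  by (metis mnorm_def real_sqrt_le_mono real_sqrt_mult real_sqrt_abs abs_norm_cancel)

section \<open>Inexact directions\<close>

lemma subdiffD: "v \<in> subdiff h x \<Longrightarrow> h x + ereal (v \<bullet> (y - x)) \<le> h y"
  by (simp add: subdiff_def)

text \<open>The residual \<open>r\<close> of the subproblem is written as \<open>H w\<close>, so that its norm with respect
  to the inverse of \<open>H\<close> becomes the norm of \<open>w\<close> with respect to \<open>H\<close>.\<close>

lemma inexact_directionE:
  assumes "pos_def H" "inexact_direction h \<gamma> x g H d"
  obtains w where "H *v (w - d) - g \<in> subdiff h (x + d)" "mnorm H w \<le> (1 - \<gamma>) * mnorm H d"
proof -
  obtain v where v: "v \<in> subdiff h (x + d)"
      "mnorm (matrix_inv H) (g + H *v d + v) \<le> (1 - \<gamma>) * mnorm H d"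
    using assms(2) by (auto simp: inexact_direction_def)
  obtain w where w: "H *v w = g + H *v d + v" "mnorm (matrix_inv H) (g + H *v d + v) = mnorm H w"
    using pos_def_inverse[OF assms(1)] .
  have "v = H *v (w - d) - g" using w(1) by (simp add: matrix_vector_mult_diff_distrib)
  then show ?thesis using that v w(2) by simp
qed

lemma young_inequality_weighted:
  fixes a b s :: real
  assumes "s > 0"
  shows "a * b \<le> s / 8 * b\<^sup>2 + 2 / s * a\<^sup>2"
proof -
  have "0 \<le> s / 8 * (b - 4 * a / s)\<^sup>2" using assms by simp
  also have "\<dots> = s / 8 * b\<^sup>2 - a * b + 2 / s * a\<^sup>2"
    using assms by (simp add: field_simps power2_eq_square)
  finally show ?thesis by simp
qed

section \<open>The optimality gap\<close>

text \<open>The problem data without the algorithm.\<close>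

locale strongly_convex_composite =
  fixes f :: "real^'n \<Rightarrow> real" and gradf :: "real^'n \<Rightarrow> real^'n" and h :: "real^'n \<Rightarrow> ereal"
    and Lf m :: real
  assumes grad: "\<And>x. GDERIV f x :> gradf x"
    and grad_lip: "Lf-lipschitz_on UNIV gradf" and Lf: "Lf > 0"
    and h: "proper h" "closed_fun h" "convex_fun h"
    and bounded_below: "\<exists>B. \<forall>x. ereal B \<le> objective f h x"
    and f_convex: "convex_on UNIV f"
    and strong: "strongly_convex_objective f gradf h m" and m: "m > 0"
begin

text \<open>The minimizer; \<open>ex1_minimizer\<close> below shows that the description is proper.\<close>

definition xstar :: "real^'n" where
  "xstar = (THE x. is_arg_min (objective f h) (\<lambda>_. True) x)"

lemma xstar_unique_growth:
  shows ex1_minimizer: "\<exists>!x. is_arg_min (objective f h) (\<lambda>_. True) x"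
    and xstar_effdom: "xstar \<in> effdom h"
    and xstar_growth: "objective f h xstar + ereal (m / 2 * (norm (x - xstar))\<^sup>2) \<le> objective f h x"
proof -
  obtain B where B: "\<And>x. ereal B \<le> objective f h x" using bounded_below by blast
  obtain p where p: "p \<in> effdom h"
      "\<And>x. objective f h p + ereal (m / 2 * (norm (x - p))\<^sup>2) \<le> objective f h x"
    using strongly_convex_minimizer[OF grad grad_lip Lf h B strong m] by blast
  obtain b where "h p = ereal b" using proper_effdomE[OF h(1) p(1)] .
  then have "\<exists>a. objective f h p = ereal a" by (simp add: objective_def)
  then obtain a where a: "objective f h p = ereal a" ..
  have "objective f h p \<le> objective f h x" for x
  proof -
    have "objective f h p \<le> objective f h p + ereal (m / 2 * (norm (x - p))\<^sup>2)"
      using m a by simp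
    then show ?thesis using p(2) by (rule order_trans)
  qed
  then have min: "is_arg_min (objective f h) (\<lambda>_. True) p"
    by (simp add: is_arg_min_linorder)
  have uniq: "x = p" if "is_arg_min (objective f h) (\<lambda>_. True) x" for x
  proof -
    have "objective f h x \<le> objective f h p" using that by (simp add: is_arg_min_linorder)
    then have "objective f h p + ereal (m / 2 * (norm (x - p))\<^sup>2) \<le> objective f h p"
      by (rule order_trans[OF p(2)])
    then have "m * (norm (x - p))\<^sup>2 \<le> 0" using a by simp
    then show ?thesis using m by (simp add: mult_le_0_iff)
  qed
  show "\<exists>!x. is_arg_min (objective f h) (\<lambda>_. True) x" using min uniq by (rule ex1I)
  have "xstar = p" unfolding xstar_def using min uniq by (rule the_equality)
  then show "xstar \<in> effdom h" using p(1) by simp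
  show "objective f h xstar + ereal (m / 2 * (norm (x - xstar))\<^sup>2) \<le> objective f h x"
    unfolding \<open>xstar = p\<close> by (rule p(2))
qed

text \<open>The distance of the objective from its minimum, as a real number. It is meaningful on the
  effective domain; elsewhere it is 0, the value of \<^const>\<open>real_of_ereal\<close> at infinity.\<close>

definition gap :: "real^'n \<Rightarrow> real" where
  "gap x = real_of_ereal (objective f h x - objective f h xstar)"

lemma
  assumes "x \<in> effdom h"
  shows objective_minus_min: "objective f h x - objective f h xstar = ereal (gap x)"
    and objective_eq_gap: "objective f h x = objective f h xstar + ereal (gap x)"
    and gap_growth: "m / 2 * (norm (x - xstar))\<^sup>2 \<le> gap x"
    and gap_nonneg: "0 \<le> gap x"
proof -
  obtain a where "h x = ereal a" using proper_effdomE[OF h(1) assms] .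
  moreover obtain b where "h xstar = ereal b" using proper_effdomE[OF h(1) xstar_effdom] .
  ultimately have ab: "h x = ereal a" "h xstar = ereal b" by simp_all
  show "objective f h x - objective f h xstar = ereal (gap x)"
    and "objective f h x = objective f h xstar + ereal (gap x)"
    using ab by (auto simp: gap_def objective_def)
  show *: "m / 2 * (norm (x - xstar))\<^sup>2 \<le> gap x"
    using xstar_growth[of x] ab by (simp add: gap_def objective_def)
  have "0 \<le> m / 2 * (norm (x - xstar))\<^sup>2" using m by simp
  then show "0 \<le> gap x" using * by linarith
qed

end

section \<open>One iteration\<close>

text \<open>The problem data together with the parameters of the algorithm.\<close>

locale zopn_setting = strongly_convex_composite f gradf h Lf m
  for f :: "real^'n \<Rightarrow> real" and gradf h Lf m +
  fixes x0 :: "real^'n" and c1 c2 \<beta> \<gamma> tbar \<kappa>eg \<kappa>l \<kappa>u :: real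
  assumes \<kappa>eg: "\<kappa>eg > 0" and \<kappa>l: "\<kappa>l > 0" and \<kappa>u: "\<kappa>u \<ge> \<kappa>l"
    and x0: "x0 \<in> effdom h"
    and c1: "0 < c1" "c1 < 1 / 2" and c2: "c2 > 0" and \<beta>: "0 < \<beta>" "\<beta> < 1"
    and \<gamma>: "0 < \<gamma>" "\<gamma> \<le> 1"
    and tbar: "\<beta> * min 1 (min (\<kappa>l * \<gamma> * (1 - 2 * c1) / Lf)
      (2 * \<kappa>l * \<gamma> * real CARD('n) * c2 / \<kappa>eg\<^sup>2)) \<le> tbar"
begin

text \<open>The largest step size whose acceptance is guaranteed; \<open>\<beta> * tmax\<close> is the lower bound on
  the accepted step sizes.\<close>

definition tmax :: real where
  "tmax = min 1 (min (\<kappa>l * \<gamma> * (1 - 2 * c1) / Lf) (2 * \<kappa>l * \<gamma> * real CARD('n) * c2 / \<kappa>eg\<^sup>2))"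

text \<open>The relative decrease per iteration: the contraction factor is \<open>1 - \<theta>\<close>.\<close>

definition \<theta> :: real where
  "\<theta> = c1 * (\<beta> * tmax) * \<kappa>l * \<gamma> / (4 * \<kappa>l * \<gamma> + 16 * \<kappa>u\<^sup>2 / m + 2 * Lf)"

text \<open>The factor of the squared sampling radius in the one-step recursion.\<close>

definition noise :: real where
  "noise = real CARD('n) * c2 + \<theta> * (1 / Lf + 8 / m) * \<kappa>eg\<^sup>2"

lemma tmax_bounds: "0 < tmax" "tmax \<le> 1" "tmax \<le> \<kappa>l * \<gamma> * (1 - 2 * c1) / Lf"
  "tmax \<le> 2 * \<kappa>l * \<gamma> * real CARD('n) * c2 / \<kappa>eg\<^sup>2"
  using \<kappa>l \<gamma> c1 c2 Lf \<kappa>eg by (auto simp: tmax_def)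

lemma denominator_pos: "0 < 4 * \<kappa>l * \<gamma> + 16 * \<kappa>u\<^sup>2 / m + 2 * Lf"
  using \<kappa>l \<gamma> m Lf by (intro add_pos_pos add_pos_nonneg mult_pos_pos) auto

lemma \<theta>_bounds: "0 < \<theta>" "\<theta> < 1"
proof -
  show "0 < \<theta>" unfolding \<theta>_def
    using denominator_pos tmax_bounds(1) \<kappa>l \<gamma> c1 \<beta> by (intro divide_pos_pos mult_pos_pos) auto
  have "\<beta> * tmax \<le> 1" using \<beta> tmax_bounds by (intro mult_le_one) auto
  then have "c1 * (\<beta> * tmax) \<le> 1" using c1 \<beta> tmax_bounds by (intro mult_le_one) auto
  then have "c1 * (\<beta> * tmax) * (\<kappa>l * \<gamma>) \<le> 1 * (\<kappa>l * \<gamma>)"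
    using \<kappa>l \<gamma> by (intro mult_right_mono) auto
  also have "\<dots> < 4 * \<kappa>l * \<gamma> + 16 * \<kappa>u\<^sup>2 / m + 2 * Lf"
  proof -
    \<comment> \<open>Already the summand \<open>4 * \<kappa>l * \<gamma>\<close> of the denominator exceeds the numerator.\<close>
    have "0 < \<kappa>l * \<gamma>" "0 \<le> 16 * \<kappa>u\<^sup>2 / m" using \<kappa>l \<gamma> m by auto
    then have "0 < 3 * (\<kappa>l * \<gamma>) + 16 * \<kappa>u\<^sup>2 / m + 2 * Lf"
      using Lf by (intro add_pos_pos add_pos_nonneg) auto
    then show ?thesis by (simp add: algebra_simps)
  qed
  finally show "\<theta> < 1" using denominator_pos by (simp add: \<theta>_def mult.assoc)
qed

lemma noise_pos: "0 < noise"
  unfolding noise_def using \<theta>_bounds Lf m \<kappa>eg c2 by (intro add_pos_pos mult_pos_pos) auto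

text \<open>The data of one iteration: the iterate \<open>x\<close>, the gradient estimate \<open>g\<close>, the approximate
  Hessian \<open>H\<close>, the direction \<open>d\<close> and the sampling radius \<open>\<Delta>\<close>; \<open>a\<close> and \<open>b\<close> are the finite values of
  \<open>h\<close> at \<open>x\<close> and \<open>x + d\<close>.\<close>

context
  fixes x g d :: "real^'n" and H :: "real^'n^'n" and \<Delta> a b :: real
  assumes H: "pos_def H" "loewner_le (mat \<kappa>l) H" "loewner_le H (mat \<kappa>u)"
    and inexact: "inexact_direction h \<gamma> x g H d"
    and g: "norm (g - gradf x) \<le> \<kappa>eg * \<Delta>"
    and a: "h x = ereal a" and b: "h (x + d) = ereal b"
begin

lemma model_decrease: "g \<bullet> d + b - a \<le> - (\<gamma> * \<kappa>l * (norm d)\<^sup>2)"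
proof -
  obtain w where w: "H *v (w - d) - g \<in> subdiff h (x + d)" "mnorm H w \<le> (1 - \<gamma>) * mnorm H d"
    using inexact_directionE[OF H(1) inexact] .
  have "h (x + d) + ereal ((H *v (w - d) - g) \<bullet> (x - (x + d))) \<le> h x"
    using w(1) by (rule subdiffD)
  then have "g \<bullet> d + b - a \<le> w \<bullet> (H *v d) - d \<bullet> (H *v d)"
    using a b pos_def_symmetric[OF H(1), of w d]
    by (simp add: matrix_vector_mult_diff_distrib inner_diff_left inner_commute algebra_simps)
  also have "w \<bullet> (H *v d) \<le> mnorm H w * mnorm H d"
    using pos_def_Cauchy_Schwarz[OF H(1), of w d] by linarith
  also have "\<dots> \<le> (1 - \<gamma>) * mnorm H d * mnorm H d"
    using w(2) mnorm_nonneg[OF H(1)] by (intro mult_right_mono)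
  also have "\<dots> - d \<bullet> (H *v d) = - (\<gamma> * (d \<bullet> (H *v d)))"
    using mnorm_power2[OF H(1), of d] by (simp add: power2_eq_square algebra_simps)
  also have "\<dots> \<le> - (\<gamma> * (\<kappa>l * (norm d)\<^sup>2))"
    using loewner_le_mat_left[OF H(2), of d] \<gamma> by simp
  finally show ?thesis by (simp add: mult.assoc)
qed

text \<open>Of the coefficient \<open>1 - c1\<close> of the predicted decrease that the acceptance test leaves
  unused, the part \<open>1 / 2\<close> pays for the gradient error, together with the slack \<open>n c2 \<Delta>\<^sup>2\<close>, and the
  part \<open>1 / 2 - c1\<close> for the curvature of \<open>f\<close>.\<close>

lemma line_search_accepts:
  assumes t: "0 \<le> t" "t \<le> tmax"
  shows "sufficient_decrease f h c1 c2 \<Delta> x g d t"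
proof -
  let ?\<Phi> = "g \<bullet> d + b - a" and ?n = "real CARD('n)"
  have "h (x + t *\<^sub>R d) \<le> ereal (a + t * (b - a))"
    using convex_fun_segment[OF h(3) a b, of t] t tmax_bounds(2) by simp
  then obtain c where c: "h (x + t *\<^sub>R d) = ereal c" "c \<le> a + t * (b - a)"
    using h(1) by (cases "h (x + t *\<^sub>R d)") (auto simp: proper_def)
  have "f (x + t *\<^sub>R d) - f x \<le> t * (gradf x \<bullet> d) + Lf / 2 * t\<^sup>2 * (norm d)\<^sup>2"
    using descent_lemma[OF grad grad_lip, of x "t *\<^sub>R d"] t by (simp add: power_mult_distrib)
  moreover have "t * (gradf x \<bullet> d) \<le> t * (g \<bullet> d + \<kappa>eg * \<Delta> * norm d)"
  proof (rule mult_left_mono)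
    have "\<bar>(g - gradf x) \<bullet> d\<bar> \<le> norm (g - gradf x) * norm d" by (rule Cauchy_Schwarz_ineq2)
    also have "\<dots> \<le> \<kappa>eg * \<Delta> * norm d" using g by (intro mult_right_mono) auto
    finally show "gradf x \<bullet> d \<le> g \<bullet> d + \<kappa>eg * \<Delta> * norm d" by (simp add: inner_diff_left)
  qed (use t in auto)
  ultimately have change: "f (x + t *\<^sub>R d) + c - (f x + a)
      \<le> t * ?\<Phi> + t * (\<kappa>eg * \<Delta> * norm d) + Lf / 2 * t\<^sup>2 * (norm d)\<^sup>2"
    using c(2) by (simp add: algebra_simps)
  have "(1 - c1) * t * ?\<Phi> \<le> (1 - c1) * t * - (\<gamma> * \<kappa>l * (norm d)\<^sup>2)"
    using model_decrease c1 t by (intro mult_left_mono) auto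
  moreover have "Lf / 2 * t\<^sup>2 * (norm d)\<^sup>2 \<le> (1 / 2 - c1) * t * (\<gamma> * \<kappa>l * (norm d)\<^sup>2)"
  proof -
    have "Lf * t \<le> \<kappa>l * \<gamma> * (1 - 2 * c1)"
      using order_trans[OF t(2) tmax_bounds(3)] Lf by (simp add: field_simps)
    then have "(t * (norm d)\<^sup>2 / 2) * (Lf * t) \<le> (t * (norm d)\<^sup>2 / 2) * (\<kappa>l * \<gamma> * (1 - 2 * c1))"
      using t(1) by (intro mult_left_mono) auto
    then show ?thesis by (simp add: power2_eq_square algebra_simps)
  qed
  moreover have "t * (\<kappa>eg * \<Delta> * norm d) \<le> t * (\<gamma> * \<kappa>l * (norm d)\<^sup>2) / 2 + ?n * c2 * \<Delta>\<^sup>2"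
  proof -
    have "\<kappa>eg * \<Delta> * norm d \<le> \<gamma> * \<kappa>l * (norm d)\<^sup>2 / 2 + (\<kappa>eg * \<Delta>)\<^sup>2 / (2 * \<kappa>l * \<gamma>)"
      using young_inequality_weighted[of "4 * \<kappa>l * \<gamma>" "\<kappa>eg * \<Delta>" "norm d"] \<kappa>l \<gamma>
      by (simp add: field_simps)
    then have "t * (\<kappa>eg * \<Delta> * norm d)
        \<le> t * (\<gamma> * \<kappa>l * (norm d)\<^sup>2 / 2 + (\<kappa>eg * \<Delta>)\<^sup>2 / (2 * \<kappa>l * \<gamma>))"
      using t(1) by (rule mult_left_mono)
    moreover have "t * ((\<kappa>eg * \<Delta>)\<^sup>2 / (2 * \<kappa>l * \<gamma>)) \<le> ?n * c2 * \<Delta>\<^sup>2"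
    proof -
      have "t * \<kappa>eg\<^sup>2 \<le> 2 * \<kappa>l * \<gamma> * ?n * c2"
        using order_trans[OF t(2) tmax_bounds(4)] \<kappa>eg by (simp add: field_simps)
      then have "t * \<kappa>eg\<^sup>2 * (\<Delta>\<^sup>2 / (2 * \<kappa>l * \<gamma>))
          \<le> 2 * \<kappa>l * \<gamma> * ?n * c2 * (\<Delta>\<^sup>2 / (2 * \<kappa>l * \<gamma>))"
        using \<kappa>l \<gamma> by (intro mult_right_mono) auto
      then show ?thesis using \<kappa>l \<gamma> by (simp add: power_mult_distrib)
    qed
    ultimately show ?thesis by (simp add: algebra_simps)
  qed
  ultimately have "f (x + t *\<^sub>R d) + c - (f x + a) \<le> c1 * t * ?\<Phi> + ?n * c2 * \<Delta>\<^sup>2"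
    using change by (simp add: algebra_simps)
  then show ?thesis
    using a b c by (simp add: sufficient_decrease_def objective_def predicted_decrease_def)
qed

text \<open>The bound that makes the convergence linear. The vector \<open>e\<close> in the proof points from \<open>x\<close>
  to the minimizer; its quadratic terms are absorbed into half of the gap.\<close>

lemma gap_le_model_decrease:
  "gap x \<le> - 2 * (g \<bullet> d + b - a) + 16 * \<kappa>u\<^sup>2 / m * (norm d)\<^sup>2 + 4 / m * (\<kappa>eg * \<Delta>)\<^sup>2"
proof -
  define e where "e = xstar - x"
  \<comment> \<open>\<open>H (w - d) - g\<close> is a subgradient of \<open>h\<close> at \<open>x + d\<close>, and \<open>w\<close> is no longer than
    \<open>d\<close> in the norm of \<open>H\<close>.\<close>
  obtain w where w: "H *v (w - d) - g \<in> subdiff h (x + d)" "mnorm H w \<le> (1 - \<gamma>) * mnorm H d"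
    using inexact_directionE[OF H(1) inexact] .
  obtain s where s: "h xstar = ereal s" using proper_effdomE[OF h(1) xstar_effdom] .
  have gap: "gap x = f x + a - (f xstar + s)"
    using a s by (simp add: gap_def objective_def)
  have "f x + gradf x \<bullet> e \<le> f xstar"
    using convex_gradient_inequality[OF f_convex grad, of x xstar] by (simp add: e_def)
  moreover have "b + (H *v (w - d) - g) \<bullet> (e - d) \<le> s"
  proof -
    have "h (x + d) + ereal ((H *v (w - d) - g) \<bullet> (xstar - (x + d))) \<le> h xstar"
      using w(1) by (rule subdiffD)
    then show ?thesis using b s by (simp add: e_def diff_diff_eq)
  qed
  ultimately have "gap x \<le> - (g \<bullet> d + b - a) + (g - gradf x) \<bullet> e
      + (w \<bullet> (H *v d) - d \<bullet> (H *v d)) + (d \<bullet> (H *v e) - w \<bullet> (H *v e))"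
    using gap pos_def_symmetric[OF H(1), of w d] pos_def_symmetric[OF H(1), of w e]
      pos_def_symmetric[OF H(1), of d e]
    by (simp add: matrix_vector_mult_diff_distrib inner_diff_left inner_diff_right inner_commute)
  moreover have "(g - gradf x) \<bullet> e \<le> m / 8 * (norm e)\<^sup>2 + 2 / m * (\<kappa>eg * \<Delta>)\<^sup>2"
  proof -
    have "(g - gradf x) \<bullet> e \<le> norm (g - gradf x) * norm e" by (rule norm_cauchy_schwarz)
    also have "\<dots> \<le> \<kappa>eg * \<Delta> * norm e" using g by (intro mult_right_mono) auto
    also have "\<dots> \<le> m / 8 * (norm e)\<^sup>2 + 2 / m * (\<kappa>eg * \<Delta>)\<^sup>2"
      using m by (rule young_inequality_weighted)
    finally show ?thesis .
  qed
  moreover have w_le: "mnorm H w \<le> mnorm H d"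
    using w(2) \<gamma> mnorm_nonneg[OF H(1), of d] mult_right_mono[of "1 - \<gamma>" 1 "mnorm H d"] by simp
  have "w \<bullet> (H *v d) - d \<bullet> (H *v d) \<le> 0"
  proof -
    have "w \<bullet> (H *v d) \<le> mnorm H w * mnorm H d"
      using pos_def_Cauchy_Schwarz[OF H(1), of w d] by linarith
    also have "\<dots> \<le> mnorm H d * mnorm H d"
      using w_le mnorm_nonneg[OF H(1)] by (intro mult_right_mono)
    finally show ?thesis using mnorm_power2[OF H(1), of d] by (simp add: power2_eq_square)
  qed
  moreover have "d \<bullet> (H *v e) - w \<bullet> (H *v e) \<le> m / 8 * (norm e)\<^sup>2 + 8 * \<kappa>u\<^sup>2 / m * (norm d)\<^sup>2"
  proof -
    have "d \<bullet> (H *v e) - w \<bullet> (H *v e) \<le> mnorm H d * mnorm H e + mnorm H w * mnorm H e"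
      using pos_def_Cauchy_Schwarz[OF H(1), of d e] pos_def_Cauchy_Schwarz[OF H(1), of w e]
      by linarith
    also have "\<dots> \<le> 2 * (mnorm H d * mnorm H e)"
      using mult_right_mono[OF w_le mnorm_nonneg[OF H(1), of e]] by simp
    also have "\<dots> \<le> 2 * ((sqrt \<kappa>u * norm d) * (sqrt \<kappa>u * norm e))"
      using \<kappa>l \<kappa>u by (intro mult_left_mono mult_mono mnorm_le H mnorm_nonneg) auto
    also have "\<dots> = (2 * \<kappa>u * norm d) * norm e" using \<kappa>l \<kappa>u by simp
    also have "\<dots> \<le> m / 8 * (norm e)\<^sup>2 + 2 / m * (2 * \<kappa>u * norm d)\<^sup>2"
      using m by (rule young_inequality_weighted)
    finally show ?thesis by (simp add: power_mult_distrib)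
  qed
  moreover have "m / 4 * (norm e)\<^sup>2 \<le> gap x / 2"
    using gap_growth[of x] a by (simp add: effdom_def e_def norm_minus_commute)
  ultimately show ?thesis by (simp add: algebra_simps)
qed


end

end

section \<open>Perturbed linear contractions\<close>

lemma contraction_unrolled:
  fixes u e :: "nat \<Rightarrow> real"
  assumes "\<And>k. u (Suc k) \<le> q * u k + e k" "0 < q"
  shows "u k \<le> q ^ k * (u 0 + (\<Sum>i<k. e i / q ^ Suc i))"
proof (induction k)
  case (Suc k)
  have "q * u k \<le> q * (q ^ k * (u 0 + (\<Sum>i<k. e i / q ^ Suc i)))"
    using Suc assms(2) by (intro mult_left_mono) auto
  then have "u (Suc k) \<le> q * (q ^ k * (u 0 + (\<Sum>i<k. e i / q ^ Suc i))) + e k"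
    using assms(1)[of k] by linarith
  also have "\<dots> = q ^ Suc k * (u 0 + (\<Sum>i<Suc k. e i / q ^ Suc i))"
    using assms(2) by (simp add: field_simps)
  finally show ?case .
qed simp

lemma contraction_constant_noise:
  fixes u :: "nat \<Rightarrow> real"
  assumes "\<And>k. u (Suc k) \<le> q * u k + e" "0 < q" "q < 1" "0 \<le> e"
  shows "u k \<le> q ^ k * u 0 + e / (1 - q)"
proof (induction k)
  case (Suc k)
  have "q * u k \<le> q * (q ^ k * u 0 + e / (1 - q))"
    using Suc assms(2) by (intro mult_left_mono) auto
  then have "u (Suc k) \<le> q * (q ^ k * u 0 + e / (1 - q)) + e"
    using assms(1)[of k] by linarith
  also have "\<dots> = q ^ Suc k * u 0 + e / (1 - q)"
    using assms(3) by (simp add: field_simps)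
  finally show ?case .
qed (use assms in simp)

text \<open>The truncation by \<^const>\<open>nat\<close> reads a negative iteration bound as 0.\<close>

lemma power_ceiling_log_le:
  fixes q y :: real
  assumes "0 < q" "q < 1" "0 < y" "nat \<lceil>log q y\<rceil> \<le> k"
  shows "q ^ k \<le> y"
proof -
  have "log q y \<le> real k" using assms(4) by linarith
  have "q ^ k = q powr real k" using assms(1) by (simp add: powr_realpow)
  also have "\<dots> \<le> q powr log q y"
    using \<open>log q y \<le> real k\<close> assms by (intro powr_mono') auto
  also have "\<dots> = y" using assms by simp
  finally show ?thesis .
qed

section \<open>The one-step recursion\<close>

context zopn_setting
begin

lemma trial_point_effdom: "inexact_direction h \<gamma> x g H d \<Longrightarrow> x + d \<in> effdom h"
  by (auto simp: inexact_direction_def subdiff_def)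

text \<open>The sufficient decrease condition, with the predicted decrease eliminated by
  \<open>gap_le_model_decrease\<close>. Only the lower bound on the step size is used, so \<open>t\<close> may exceed 1.\<close>

lemma zopn_step:
  assumes x: "x \<in> effdom h"
    and H: "pos_def H" "loewner_le (mat \<kappa>l) H" "loewner_le H (mat \<kappa>u)"
    and inexact: "inexact_direction h \<gamma> x g H d"
    and g: "norm (g - gradf x) \<le> \<kappa>eg * \<Delta>"
    and t: "\<beta> * tmax \<le> t"
    and accept: "sufficient_decrease f h c1 c2 \<Delta> x g d t"
  shows "x + t *\<^sub>R d \<in> effdom h"
    and "gap (x + t *\<^sub>R d) \<le> (1 - \<theta>) * gap x + noise * \<Delta>\<^sup>2"
proof -
  obtain a where a: "h x = ereal a" using proper_effdomE[OF h(1) x] .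
  obtain b where b: "h (x + d) = ereal b"
    using proper_effdomE[OF h(1) trial_point_effdom[OF inexact]] .
  define \<Phi> where "\<Phi> = g \<bullet> d + b - a"
  define D where "D = 4 * \<kappa>l * \<gamma> + 16 * \<kappa>u\<^sup>2 / m + 2 * Lf"
  define p where "p = (\<kappa>eg * \<Delta>)\<^sup>2"
  have D: "D > 0" using denominator_pos by (simp add: D_def)
  have F: "objective f h (x + t *\<^sub>R d) - ereal (f x + a)
      \<le> ereal (c1 * t * \<Phi> + real CARD('n) * c2 * \<Delta>\<^sup>2)"
    using accept a b by (simp add: sufficient_decrease_def objective_def predicted_decrease_def \<Phi>_def)
  show dom: "x + t *\<^sub>R d \<in> effdom h"
    using F by (cases "h (x + t *\<^sub>R d)") (auto simp: objective_def effdom_def)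
  obtain c where c: "h (x + t *\<^sub>R d) = ereal c" using proper_effdomE[OF h(1) dom] .
  obtain s where s: "h xstar = ereal s" using proper_effdomE[OF h(1) xstar_effdom] .
  have decrease: "gap (x + t *\<^sub>R d) \<le> gap x + c1 * t * \<Phi> + real CARD('n) * c2 * \<Delta>\<^sup>2"
    using F a c s by (simp add: gap_def objective_def)
  have \<Phi>: "\<Phi> \<le> - (\<gamma> * \<kappa>l * (norm d)\<^sup>2)"
    using model_decrease[OF H inexact g a b] by (simp add: \<Phi>_def)
  have pos: "0 < \<gamma> * \<kappa>l" "0 \<le> \<gamma> * \<kappa>l * (norm d)\<^sup>2" using \<gamma> \<kappa>l by auto
  then have \<Phi>_nonpos: "\<Phi> \<le> 0" using \<Phi> by linarith
  have "\<kappa>l * \<gamma> * (gap x - 4 / m * p) \<le> D * - \<Phi>"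
  proof -
    have "gap x - 4 / m * p \<le> - 2 * \<Phi> + 16 * \<kappa>u\<^sup>2 / m * (norm d)\<^sup>2"
      using gap_le_model_decrease[OF H inexact g a b] by (simp add: \<Phi>_def p_def)
    then have "\<kappa>l * \<gamma> * (gap x - 4 / m * p)
        \<le> \<kappa>l * \<gamma> * (- 2 * \<Phi> + 16 * \<kappa>u\<^sup>2 / m * (norm d)\<^sup>2)"
      using pos by (intro mult_left_mono) (auto simp: mult.commute)
    also have "\<dots> = 2 * \<kappa>l * \<gamma> * - \<Phi> + 16 * \<kappa>u\<^sup>2 / m * (\<gamma> * \<kappa>l * (norm d)\<^sup>2)"
      by (simp add: algebra_simps)
    also have "\<dots> \<le> 2 * \<kappa>l * \<gamma> * - \<Phi> + 16 * \<kappa>u\<^sup>2 / m * - \<Phi>"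
      using \<Phi> m by (intro add_left_mono mult_left_mono) auto
    also have "\<dots> = (2 * \<kappa>l * \<gamma> + 16 * \<kappa>u\<^sup>2 / m) * - \<Phi>" by (simp add: algebra_simps)
    \<comment> \<open>This discards the surplus \<open>2 * \<kappa>l * \<gamma> + 2 * Lf\<close> of the denominator.\<close>
    also have "\<dots> \<le> D * - \<Phi>"
      using \<Phi>_nonpos pos Lf by (intro mult_right_mono) (auto simp: D_def mult.commute mult.left_commute)
    finally show ?thesis .
  qed
  then have "(c1 * (\<beta> * tmax) / D) * (\<kappa>l * \<gamma> * (gap x - 4 / m * p))
      \<le> (c1 * (\<beta> * tmax) / D) * (D * - \<Phi>)"
    using c1 \<beta> tmax_bounds(1) D by (intro mult_left_mono) auto
  also have "\<dots> = c1 * (\<beta> * tmax) * - \<Phi>" using D by simp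
  also have "\<dots> \<le> c1 * t * - \<Phi>"
    using c1 t \<Phi>_nonpos by (intro mult_right_mono mult_left_mono) auto
  also have "(c1 * (\<beta> * tmax) / D) * (\<kappa>l * \<gamma> * (gap x - 4 / m * p)) = \<theta> * (gap x - 4 / m * p)"
    by (simp add: \<theta>_def D_def)
  finally have "gap (x + t *\<^sub>R d)
      \<le> (1 - \<theta>) * gap x + \<theta> * (4 / m) * p + real CARD('n) * c2 * \<Delta>\<^sup>2"
    using decrease by (simp add: algebra_simps)
  moreover have "\<theta> * (4 / m) * p \<le> \<theta> * (1 / Lf + 8 / m) * p"
  proof (intro mult_right_mono mult_left_mono)
    have "4 / m \<le> 8 / m" using m by (simp add: divide_right_mono)
    then show "4 / m \<le> 1 / Lf + 8 / m" using Lf by (simp add: add_increasing)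
  qed (use \<theta>_bounds in \<open>auto simp: p_def\<close>)
  moreover have "noise * \<Delta>\<^sup>2 = \<theta> * (1 / Lf + 8 / m) * p + real CARD('n) * c2 * \<Delta>\<^sup>2"
    by (simp add: noise_def p_def power_mult_distrib distrib_right)
  ultimately show "gap (x + t *\<^sub>R d) \<le> (1 - \<theta>) * gap x + noise * \<Delta>\<^sup>2" by linarith
qed

section \<open>Runs of the algorithm\<close>

lemma tbar_ge: "\<beta> * tmax \<le> tbar"
  using tbar by (simp add: tmax_def)

lemma tbar_pos: "0 < tbar"
  using \<beta> tmax_bounds(1) tbar_ge by (smt (verit) mult_pos_pos)

context
  fixes R :: "'n zopn"
  assumes run: "zopn_run f h c1 c2 \<beta> \<gamma> tbar x0 R"
    and estimates: "estimate_bounds gradf \<kappa>eg \<kappa>l \<kappa>u R"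
begin

lemma runD:
  shows "iterate R 0 = x0" "0 < radius R k" "pos_def (hessian_est R k)"
    "inexact_direction h \<gamma> (iterate R k) (gradient_est R k) (hessian_est R k) (direction R k)"
    "sufficient_decrease f h c1 c2 (radius R k) (iterate R k)
       (gradient_est R k) (direction R k)
       (tbar * \<beta> ^ backtracks R k)"
    "i < backtracks R k \<Longrightarrow> \<not> sufficient_decrease f h c1 c2 (radius R k) (iterate R k)
       (gradient_est R k) (direction R k) (tbar * \<beta> ^ i)"
    "iterate R (Suc k) = iterate R k + (tbar * \<beta> ^ backtracks R k) *\<^sub>R direction R k"
  using run by (auto simp: zopn_run_def Let_def)

lemma estimatesD:
  "norm (gradient_est R k - gradf (iterate R k)) \<le> \<kappa>eg * radius R k"
  "loewner_le (mat \<kappa>l) (hessian_est R k)" "loewner_le (hessian_est R k) (mat \<kappa>u)"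
  using estimates by (auto simp: estimate_bounds_def)

lemma step_size_ge:
  assumes "iterate R k \<in> effdom h"
  shows "\<beta> * tmax \<le> tbar * \<beta> ^ backtracks R k"
proof (cases "backtracks R k")
  case (Suc i)
  obtain a where a: "h (iterate R k) = ereal a" using proper_effdomE[OF h(1) assms] .
  obtain b where b: "h (iterate R k + direction R k) = ereal b"
    using proper_effdomE[OF h(1) trial_point_effdom[OF runD(4)]] .
  have "0 \<le> tbar * \<beta> ^ i" using tbar_pos \<beta> by simp
  \<comment> \<open>The trial before the accepted one was rejected, so its step size exceeds \<open>tmax\<close>.\<close>
  moreover have "\<not> sufficient_decrease f h c1 c2 (radius R k) (iterate R k)
      (gradient_est R k) (direction R k) (tbar * \<beta> ^ i)"
    using runD(6) Suc by simp
  ultimately have "tmax < tbar * \<beta> ^ i"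
    using line_search_accepts[OF runD(3) estimatesD(2,3) runD(4) estimatesD(1) a b] by fastforce
  then show ?thesis using \<beta> Suc by simp
qed (use tbar_ge in simp)

lemma iterate_effdom: "iterate R k \<in> effdom h"
proof (induction k)
  case (Suc k)
  show ?case
    unfolding runD(7)
    by (rule zopn_step(1)[OF Suc runD(3) estimatesD(2,3) runD(4) estimatesD(1)
          step_size_ge[OF Suc] runD(5)])
qed (use runD(1) x0 in simp)

lemma gap_recursion: "gap (iterate R (Suc k)) \<le> (1 - \<theta>) * gap (iterate R k) + noise * (radius R k)\<^sup>2"
  unfolding runD(7)
  by (rule zopn_step(2)[OF iterate_effdom runD(3) estimatesD(2,3) runD(4) estimatesD(1)
        step_size_ge[OF iterate_effdom] runD(5)])

lemma backtracks_le: "real (backtracks R k) \<le> log \<beta> (\<beta> * tmax / tbar)"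
proof (rule ccontr)
  assume "\<not> ?thesis"
  then have "\<beta> powr real (backtracks R k) < \<beta> powr log \<beta> (\<beta> * tmax / tbar)"
    using \<beta> by (intro powr_less_mono') auto
  moreover have pos: "0 < \<beta> * tmax" "0 < tbar" using \<beta> tmax_bounds(1) tbar_pos by auto
  ultimately have "\<beta> ^ backtracks R k < \<beta> * tmax / tbar"
    using \<beta> by (simp add: powr_realpow)
  then show False
    using step_size_ge[OF iterate_effdom, of k] pos by (simp add: field_simps)
qed

lemma gap_constant_radius:
  assumes "\<And>k. radius R k = \<Delta>" "\<Delta> \<le> sqrt (\<theta> * \<epsilon> / (2 * noise))" "0 < \<epsilon>"
  shows "gap (iterate R k) \<le> (1 - \<theta>) ^ k * gap x0 + \<epsilon> / 2"
proof -
  have "0 < \<Delta>" using runD(2)[of 0] assms(1) by simp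
  then have "\<Delta>\<^sup>2 \<le> \<theta> * \<epsilon> / (2 * noise)"
    using assms(2,3) \<theta>_bounds noise_pos by (metis less_imp_le power_mono real_sqrt_pow2
        divide_nonneg_pos mult_nonneg_nonneg mult_pos_pos zero_less_numeral)
  then have "noise * \<Delta>\<^sup>2 / \<theta> \<le> \<epsilon> / 2"
    using \<theta>_bounds noise_pos by (simp add: field_simps)
  moreover have "gap (iterate R k)
      \<le> (1 - \<theta>) ^ k * gap (iterate R 0) + noise * \<Delta>\<^sup>2 / (1 - (1 - \<theta>))"
    using gap_recursion \<theta>_bounds noise_pos assms(1)
    by (intro contraction_constant_noise) auto
  then have "gap (iterate R k) \<le> (1 - \<theta>) ^ k * gap x0 + noise * \<Delta>\<^sup>2 / \<theta>"
    using runD(1) by simp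
  ultimately show ?thesis by linarith
qed

lemma gap_summable_radii:
  assumes "(\<lambda>k. (radius R k)\<^sup>2 * (1 - \<theta>) powi (- int k)) sums S"
  shows "gap (iterate R k) \<le> (1 - \<theta>) ^ k * (gap x0 + noise * S / (1 - \<theta>))" "0 < S"
proof -
  let ?q = "1 - \<theta>" and ?s = "\<lambda>k. (radius R k)\<^sup>2 * (1 - \<theta>) powi (- int k)"
  have pos: "0 < ?s i" for i
    using runD(2)[of i] \<theta>_bounds by simp
  have partial: "(\<Sum>i<k. ?s i) \<le> S" for k
    using sum_le_suminf[OF sums_summable[OF assms], of "{..<k}"] pos sums_unique[OF assms]
    by (simp add: less_imp_le)
  have "(\<Sum>i<1. ?s i) = ?s 0" by simp
  then show "0 < S" using pos[of 0] partial[of 1] by linarith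
  have "gap (iterate R k)
      \<le> ?q ^ k * (gap (iterate R 0) + (\<Sum>i<k. noise * (radius R i)\<^sup>2 / ?q ^ Suc i))"
    using gap_recursion \<theta>_bounds by (intro contraction_unrolled) auto
  also have "(\<Sum>i<k. noise * (radius R i)\<^sup>2 / ?q ^ Suc i) = noise / ?q * (\<Sum>i<k. ?s i)"
    by (simp add: sum_distrib_left power_int_minus divide_inverse mult_ac)
  also have "?q ^ k * (gap (iterate R 0) + noise / ?q * (\<Sum>i<k. ?s i))
      \<le> ?q ^ k * (gap (iterate R 0) + noise / ?q * S)"
    using \<theta>_bounds noise_pos partial by (intro mult_left_mono add_left_mono) auto
  finally show "gap (iterate R k) \<le> ?q ^ k * (gap x0 + noise * S / ?q)"
    using runD(1) by simp
qed

end

end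

section \<open>Function evaluations\<close>

text \<open>The number \<open>K\<close> depends on \<open>\<epsilon>\<close> but not on the run. The constant \<open>M\<close> stands for the
  initial gap including the accumulated noise, and \<open>L\<close> for a bound on the rejected trials of one
  line search.\<close>

lemma eventually_evals_le:
  fixes q M L cg cH sH :: real and sg :: nat and hs :: "nat \<Rightarrow> nat"
  defines "n \<equiv> real CARD('n::finite)"
  assumes q: "0 < q" "q < 1" and M: "0 < M" and L: "0 \<le> L" and sg: "real sg \<le> cg * n"
    and hs: "(\<lambda>T. real (\<Sum>k<T. hs k) / real T) \<longlonglongrightarrow> sH" and sH: "sH \<le> cH * n"
  shows "\<forall>\<^sub>F \<epsilon> in at_right 0. \<exists>K. q ^ K * M \<le> \<epsilon> \<and>
    (\<forall>R :: 'n zopn. (\<forall>k. real (backtracks R k) \<le> L) \<longrightarrow>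
       real (zopn_evals sg hs R K) \<le> 2 * (cg + cH + 3 + L) / ln (1 / q) * n * ln (1 / \<epsilon>))"
proof -
  define l where "l = ln (1 / q)"
  define A where "A = cg + cH + 3 + L"
  have l: "0 < l" using q by (simp add: l_def)
  have n: "1 \<le> n" by (simp add: n_def Suc_le_eq)
  have cg: "0 \<le> cg"
  proof -
    have "0 \<le> cg * n" using sg of_nat_0_le_iff[of sg] by linarith
    then show ?thesis using n by (simp add: zero_le_mult_iff)
  qed
  have "0 \<le> sH" by (rule LIMSEQ_le_const[OF hs]) (auto intro!: divide_nonneg_nonneg sum_nonneg)
  then have cH: "0 \<le> cH" using sH n by (smt (verit) zero_le_mult_iff)
  have A: "0 \<le> A" using cg cH L by (simp add: A_def)
  have "\<forall>\<^sub>F T in sequentially. real (\<Sum>k<T. hs k) / real T < cH * n + 1"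
    using sH by (intro order_tendstoD(2)[OF hs]) simp
  then obtain T0 where T0: "\<And>T. T0 \<le> T \<Longrightarrow> real (\<Sum>k<T. hs k) / real T < cH * n + 1"
    by (auto simp: eventually_sequentially)
  \<comment> \<open>The first bound makes \<open>K\<close> so large that the average of \<open>hs\<close> over the first \<open>K\<close> iterations
    is below \<open>cH * n + 1\<close>; the second one lets half of the final bound absorb the constant \<open>M\<close> and
    the rounding of \<open>K\<close>.\<close>
  define Z where "Z = max (real (T0 + 1) * l - ln M) (ln M + l)"
  have "\<forall>\<^sub>F \<epsilon> in at_right 0. ln \<epsilon> \<le> - Z"
    using ln_at_0 by (simp add: filterlim_at_bot)
  moreover have "\<forall>\<^sub>F \<epsilon> in at_right (0::real). 0 < \<epsilon>" by (rule eventually_at_right_less)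
  ultimately show ?thesis
  proof eventually_elim
    case (elim \<epsilon>)
    define K where "K = nat \<lceil>log q (\<epsilon> / M)\<rceil>"
    have log_eq: "log q (\<epsilon> / M) = (ln (1 / \<epsilon>) + ln M) / l"
      using elim(2) M q by (simp add: log_def l_def ln_div divide_simps)
    have y: "real (T0 + 1) * l - ln M \<le> ln (1 / \<epsilon>)" "ln M + l \<le> ln (1 / \<epsilon>)"
      using elim by (auto simp: Z_def ln_div)
    have "real (T0 + 1) \<le> log q (\<epsilon> / M)"
      using y(1) l unfolding log_eq by (simp add: field_simps)
    then have K_ge: "T0 \<le> K" "1 \<le> K" unfolding K_def by linarith+
    have "real K \<le> log q (\<epsilon> / M) + 1"
      using \<open>real (T0 + 1) \<le> log q (\<epsilon> / M)\<close> unfolding K_def by linarith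
    also have "\<dots> = (ln (1 / \<epsilon>) + ln M + l) / l"
      unfolding log_eq using l by (simp add: add_divide_distrib)
    also have "\<dots> \<le> 2 * ln (1 / \<epsilon>) / l"
      using y(2) l by (intro divide_right_mono) auto
    finally have K_le: "real K \<le> 2 * ln (1 / \<epsilon>) / l" .
    have "q ^ K \<le> \<epsilon> / M"
      using q M elim(2) by (intro power_ceiling_log_le) (auto simp: K_def)
    then have "q ^ K * M \<le> \<epsilon>" using M by (simp add: field_simps)
    moreover have "real (zopn_evals sg hs R K) \<le> 2 * A / l * n * ln (1 / \<epsilon>)"
      if b: "\<And>k. real (backtracks R k) \<le> L" for R :: "'n zopn"
    proof -
      have "real (\<Sum>k<K. hs k) \<le> real K * (cH * n + 1)"
        using T0[OF K_ge(1)] K_ge(2) by (simp add: field_simps less_imp_le)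
      moreover have "(\<Sum>k<K. real (backtracks R k) + 1) \<le> real K * (L + 1)"
        using sum_bounded_above[of "{..<K}" "\<lambda>k. real (backtracks R k) + 1" "L + 1"] b by simp
      moreover have "real K * real sg \<le> real K * (cg * n)" using sg by (rule mult_left_mono) simp
      moreover have "real (zopn_evals sg hs R K)
          = 1 + real K * real sg + real (\<Sum>k<K. hs k) + (\<Sum>k<K. real (backtracks R k) + 1)"
        by (simp add: zopn_evals_def sum.distrib algebra_simps)
      ultimately have "real (zopn_evals sg hs R K)
          \<le> 1 + real K * (cg * n) + real K * (cH * n + 1) + real K * (L + 1)"
        by linarith
      also have "\<dots> \<le> real K * n * A"
      proof -
        have "1 \<le> real K * n" using K_ge(2) n mult_mono[of 1 "real K" 1 n] by simp
        moreover have "real K * (L + 2) \<le> real K * (n * (L + 2))"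
          using n L mult_right_mono[of 1 n "L + 2"] by (intro mult_left_mono) auto
        ultimately show ?thesis by (simp add: A_def algebra_simps)
      qed
      also have "\<dots> \<le> 2 * ln (1 / \<epsilon>) / l * n * A"
        using K_le A n by (intro mult_right_mono) auto
      finally show ?thesis by (simp add: mult_ac)
    qed
    ultimately show ?case unfolding A_def l_def by blast
  qed
qed

section \<open>Complexity\<close>

theorem theorem3p7:
  fixes f :: "real^'n \<Rightarrow> real" and gradf :: "real^'n \<Rightarrow> real^'n"
    and h :: "real^'n \<Rightarrow> ereal" and x0 :: "real^'n"
    and c1 c2 \<beta> \<gamma> tbar Lf m \<kappa>eg \<kappa>l \<kappa>u :: real
  defines "n \<equiv> real CARD('n)"
    and "F \<equiv> objective f h"
  defines "tlow \<equiv> \<beta> * min 1 (min (\<kappa>l * \<gamma> * (1 - 2 * c1) / Lf)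
                                (2 * \<kappa>l * \<gamma> * n * c2 / \<kappa>eg\<^sup>2))"
  defines "\<tau> \<equiv> 1 - c1 * tlow * \<kappa>l * \<gamma> / (4 * \<kappa>l * \<gamma> + 16 * \<kappa>u\<^sup>2 / m + 2 * Lf)"
    and "\<omega> \<equiv> c1 * tlow * \<kappa>l * \<gamma> * (1 / Lf + 8 / m)
                / (4 * \<kappa>l * \<gamma> + 16 * \<kappa>u\<^sup>2 / m + 2 * Lf)"
    and "xstar \<equiv> (THE x. is_arg_min F (\<lambda>_. True) x)"
  defines "gap0 \<equiv> real_of_ereal (F x0 - F xstar)"
    and "run \<equiv> (\<lambda>R. zopn_run f h c1 c2 \<beta> \<gamma> tbar x0 R \<and> estimate_bounds gradf \<kappa>eg \<kappa>l \<kappa>u R)"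
    and "eps_opt \<equiv> (\<lambda>R \<epsilon> k. F (iterate R k) - F xstar \<le> ereal \<epsilon>)"
    and "radii_i \<equiv> (\<lambda>R \<epsilon>. \<exists>\<Delta>. (\<forall>k. radius R k = \<Delta>) \<and>
                       \<Delta> \<le> sqrt ((1 - \<tau>) * \<epsilon> / (2 * (n * c2 + \<omega> * \<kappa>eg\<^sup>2))))"
    and "radii_ii \<equiv> (\<lambda>R S2. (\<lambda>k. (radius R k)\<^sup>2 * \<tau> powi (- int k)) sums (S2 / n))"
  assumes grad: "\<And>x. GDERIV f x :> gradf x" and grad_cont: "continuous_on UNIV gradf"
    and grad_lip: "Lf-lipschitz_on UNIV gradf" and Lf: "Lf > 0"
    and h: "proper h" "closed_fun h" "convex_fun h"
    and bounded_below: "\<exists>B. \<forall>x. ereal B \<le> F x"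
    and f_convex: "convex_on UNIV f"
    and strong: "strongly_convex_objective f gradf h m" and m: "m > 0"
    and \<kappa>eg: "\<kappa>eg > 0" and \<kappa>: "\<kappa>l > 0" "\<kappa>u \<ge> \<kappa>l"
    and x0: "x0 \<in> effdom F"
    and params: "c1 \<in> {0<..<1/2}" "c2 > 0" "\<beta> \<in> {0<..<1}" "\<gamma> \<in> {0<..1}"
    and tbar: "tbar > 0" "tbar \<ge> tlow"
  shows "(\<exists>!x. is_arg_min F (\<lambda>_. True) x) \<and> \<tau> \<in> {0<..<1} \<and> \<omega> > 0 \<and>
    (\<forall>R \<epsilon>. run R \<longrightarrow> \<epsilon> > 0 \<longrightarrow> radii_i R \<epsilon> \<longrightarrow> F x0 > F xstar \<longrightarrow>
       (\<exists>k \<le> nat \<lceil>log \<tau> (\<epsilon> / (2 * gap0))\<rceil>. eps_opt R \<epsilon> k)) \<and>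
    (\<forall>R \<epsilon> S2. run R \<longrightarrow> \<epsilon> > 0 \<longrightarrow> radii_ii R S2 \<longrightarrow>
       (\<exists>k \<le> nat \<lceil>log \<tau> (\<epsilon> / (gap0 + (c2 + \<omega> * \<kappa>eg\<^sup>2 / n) * S2 / \<tau>))\<rceil>. eps_opt R \<epsilon> k)) \<and>
    (\<forall>(sg::nat) (hs :: nat \<Rightarrow> nat) sH cg cH S2.
       real sg \<le> cg * n \<longrightarrow>
       (\<lambda>T. real (\<Sum>k<T. hs k) / real T) \<longlonglongrightarrow> sH \<longrightarrow> sH \<le> cH * n \<longrightarrow>
       (\<forall>\<^sub>F \<epsilon> in at_right 0. \<forall>R. run R \<longrightarrow> radii_i R \<epsilon> \<or> radii_ii R S2 \<longrightarrow>
          (\<exists>K. eps_opt R \<epsilon> K \<and>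
               real (zopn_evals sg hs R K)
                 \<le> zopn_eval_const \<tau> \<beta> tbar tlow cg cH * n * ln (1 / \<epsilon>))))"
proof -
  interpret Z: zopn_setting f gradf h Lf m x0 c1 c2 \<beta> \<gamma> tbar \<kappa>eg \<kappa>l \<kappa>u
    using grad grad_lip Lf h bounded_below f_convex strong m \<kappa>eg \<kappa> x0 params tbar
    by unfold_locales (auto simp: F_def tlow_def n_def)
  have xstar: "xstar = Z.xstar" by (simp add: xstar_def F_def Z.xstar_def)
  have tlow: "tlow = \<beta> * Z.tmax" by (simp add: tlow_def Z.tmax_def n_def)
  have \<tau>: "\<tau> = 1 - Z.\<theta>" by (simp add: \<tau>_def Z.\<theta>_def tlow)
  have \<omega>: "\<omega> = Z.\<theta> * (1 / Lf + 8 / m)" by (simp add: \<omega>_def Z.\<theta>_def tlow)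
  have noise: "n * c2 + \<omega> * \<kappa>eg\<^sup>2 = Z.noise" by (simp add: Z.noise_def \<omega> n_def)
  have n: "n > 0" by (simp add: n_def)
  have gap0: "gap0 = Z.gap x0" by (simp add: gap0_def Z.gap_def xstar F_def)
  have gap0_nonneg: "0 \<le> gap0" using Z.gap_nonneg[OF Z.x0] by (simp add: gap0)
  have \<tau>_bounds: "0 < \<tau>" "\<tau> < 1" using Z.\<theta>_bounds by (simp_all add: \<tau>)
  have runD: "zopn_run f h c1 c2 \<beta> \<gamma> tbar x0 R" "estimate_bounds gradf \<kappa>eg \<kappa>l \<kappa>u R" if "run R" for R
    using that by (simp_all add: run_def)
  have eps_optI: "eps_opt R \<epsilon> k" if "run R" "Z.gap (iterate R k) \<le> \<epsilon>" for R \<epsilon> k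
    using that Z.objective_minus_min[OF Z.iterate_effdom[OF runD[OF that(1)]]]
    by (simp add: eps_opt_def F_def xstar)

  have gap_i: "Z.gap (iterate R k) \<le> \<tau> ^ k * gap0 + \<epsilon> / 2"
    if R: "run R" and \<epsilon>: "\<epsilon> > 0" and radii: "radii_i R \<epsilon>" for R \<epsilon> k
  proof -
    obtain \<Delta> where "\<And>k. radius R k = \<Delta>" "\<Delta> \<le> sqrt (Z.\<theta> * \<epsilon> / (2 * Z.noise))"
      using radii unfolding radii_i_def noise \<tau> by auto
    from Z.gap_constant_radius[OF runD[OF R] this \<epsilon>] show ?thesis
      by (simp add: \<tau> gap0)
  qed
  have gap_ii: "Z.gap (iterate R k) \<le> \<tau> ^ k * (gap0 + (c2 + \<omega> * \<kappa>eg\<^sup>2 / n) * S2 / \<tau>)"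
      and S2_pos: "0 < (c2 + \<omega> * \<kappa>eg\<^sup>2 / n) * S2 / \<tau>"
    if R: "run R" and radii: "radii_ii R S2" for R S2 k
  proof -
    have sums: "(\<lambda>k. (radius R k)\<^sup>2 * (1 - Z.\<theta>) powi (- int k)) sums (S2 / n)"
      using radii by (simp only: radii_ii_def \<tau>)
    have noise_sum: "(c2 + \<omega> * \<kappa>eg\<^sup>2 / n) * S2 / \<tau> = Z.noise * (S2 / n) / \<tau>"
      using n by (simp add: noise[symmetric] field_simps)
    show "Z.gap (iterate R k) \<le> \<tau> ^ k * (gap0 + (c2 + \<omega> * \<kappa>eg\<^sup>2 / n) * S2 / \<tau>)"
      unfolding noise_sum using Z.gap_summable_radii(1)[OF runD[OF R] sums] by (simp add: \<tau> gap0)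
    show "0 < (c2 + \<omega> * \<kappa>eg\<^sup>2 / n) * S2 / \<tau>"
      unfolding noise_sum
      using Z.gap_summable_radii(2)[OF runD[OF R] sums] Z.noise_pos \<tau>_bounds n
      by (simp add: zero_less_mult_iff zero_less_divide_iff)
  qed

  have part_i: "\<exists>k \<le> nat \<lceil>log \<tau> (\<epsilon> / (2 * gap0))\<rceil>. eps_opt R \<epsilon> k"
    if R: "run R" and \<epsilon>: "\<epsilon> > 0" and radii: "radii_i R \<epsilon>" and less: "F x0 > F xstar" for R \<epsilon>
  proof (intro exI conjI)
    let ?K = "nat \<lceil>log \<tau> (\<epsilon> / (2 * gap0))\<rceil>"
    have "gap0 \<noteq> 0"
      using less Z.objective_eq_gap[OF Z.x0] by (auto simp: gap0 F_def xstar)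
    then have pos: "0 < gap0" using gap0_nonneg by simp
    then have "\<tau> ^ ?K \<le> \<epsilon> / (2 * gap0)"
      using \<tau>_bounds \<epsilon> by (intro power_ceiling_log_le) auto
    then have "\<tau> ^ ?K * gap0 \<le> \<epsilon> / 2" using pos by (simp add: field_simps)
    then have "Z.gap (iterate R ?K) \<le> \<epsilon>" using gap_i[OF R \<epsilon> radii, of ?K] by simp
    then show "eps_opt R \<epsilon> ?K" by (rule eps_optI[OF R])
  qed simp

  have part_ii: "\<exists>k \<le> nat \<lceil>log \<tau> (\<epsilon> / (gap0 + (c2 + \<omega> * \<kappa>eg\<^sup>2 / n) * S2 / \<tau>))\<rceil>. eps_opt R \<epsilon> k"
    if R: "run R" and \<epsilon>: "\<epsilon> > 0" and radii: "radii_ii R S2" for R \<epsilon> S2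
  proof (intro exI conjI)
    let ?M = "gap0 + (c2 + \<omega> * \<kappa>eg\<^sup>2 / n) * S2 / \<tau>"
    let ?K = "nat \<lceil>log \<tau> (\<epsilon> / ?M)\<rceil>"
    have pos: "0 < ?M" using gap0_nonneg S2_pos[OF R radii] by simp
    then have "\<tau> ^ ?K \<le> \<epsilon> / ?M"
      using \<tau>_bounds \<epsilon> by (intro power_ceiling_log_le) auto
    then have "\<tau> ^ ?K * ?M \<le> \<epsilon>" using pos by (simp add: pos_le_divide_eq)
    then have "Z.gap (iterate R ?K) \<le> \<epsilon>" using gap_ii[OF R radii, of ?K] by linarith
    then show "eps_opt R \<epsilon> ?K" by (rule eps_optI[OF R])
  qed simp

  have part_iii: "\<forall>\<^sub>F \<epsilon> in at_right 0. \<forall>R. run R \<longrightarrow> radii_i R \<epsilon> \<or> radii_ii R S2 \<longrightarrow>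
      (\<exists>K. eps_opt R \<epsilon> K \<and>
           real (zopn_evals sg hs R K) \<le> zopn_eval_const \<tau> \<beta> tbar tlow cg cH * n * ln (1 / \<epsilon>))"
    if sg: "real sg \<le> cg * n" and hs: "(\<lambda>T. real (\<Sum>k<T. hs k) / real T) \<longlonglongrightarrow> sH"
      and sH: "sH \<le> cH * n" for sg :: nat and hs :: "nat \<Rightarrow> nat" and sH cg cH S2
  proof -
    \<comment> \<open>Large enough for both kinds of radii; the absolute value and the summand 1 keep it
      positive for arbitrary \<open>S2\<close> and for a zero initial gap.\<close>
    define M where "M = 2 * gap0 + \<bar>(c2 + \<omega> * \<kappa>eg\<^sup>2 / n) * S2 / \<tau>\<bar> + 1"
    have M: "0 < M" using gap0_nonneg by (simp add: M_def add_nonneg_pos)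
    have "0 < tlow" "tlow \<le> tbar" using Z.tmax_bounds(1) Z.\<beta> Z.tbar_ge by (simp_all add: tlow)
    then have "0 \<le> log \<beta> (tlow / tbar)"
      using Z.\<beta> by (auto simp: log_def ln_div intro!: divide_nonpos_neg)
    from eventually_evals_le[where 'n = 'n, OF \<tau>_bounds M this sg[unfolded n_def] hs sH[unfolded n_def]]
      and eventually_at_right_less[of "0::real"]
    show ?thesis
    proof eventually_elim
      case (elim \<epsilon>)
      then obtain K where K: "\<tau> ^ K * M \<le> \<epsilon>"
        "\<And>R :: 'n zopn. (\<And>k. real (backtracks R k) \<le> log \<beta> (tlow / tbar)) \<Longrightarrow>
          real (zopn_evals sg hs R K) \<le> zopn_eval_const \<tau> \<beta> tbar tlow cg cH * n * ln (1 / \<epsilon>)"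
        by (auto simp: zopn_eval_const_def n_def)
      have "eps_opt R \<epsilon> K" if R: "run R" and radii: "radii_i R \<epsilon> \<or> radii_ii R S2" for R
      proof (rule eps_optI[OF R])
        have pow: "0 < \<tau> ^ K" using \<tau>_bounds by simp
        from radii show "Z.gap (iterate R K) \<le> \<epsilon>"
        proof
          assume "radii_i R \<epsilon>"
          from gap_i[OF R elim(2) this, of K]
          have "Z.gap (iterate R K) \<le> \<tau> ^ K * gap0 + \<epsilon> / 2" .
          moreover have "\<tau> ^ K * (2 * gap0) \<le> \<tau> ^ K * M"
            using pow by (intro mult_left_mono) (auto simp: M_def)
          ultimately show ?thesis using K(1) by simp
        next
          assume "radii_ii R S2"
          from gap_ii[OF R this, of K]
          have "Z.gap (iterate R K) \<le> \<tau> ^ K * (gap0 + (c2 + \<omega> * \<kappa>eg\<^sup>2 / n) * S2 / \<tau>)" .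
          also have "\<dots> \<le> \<tau> ^ K * M"
          proof (rule mult_left_mono)
            show "gap0 + (c2 + \<omega> * \<kappa>eg\<^sup>2 / n) * S2 / \<tau> \<le> M"
              unfolding M_def using gap0_nonneg by linarith
          qed (use pow in simp)
          finally show ?thesis using K(1) by simp
        qed
      qed
      moreover have "real (zopn_evals sg hs R K)
          \<le> zopn_eval_const \<tau> \<beta> tbar tlow cg cH * n * ln (1 / \<epsilon>)" if "run R" for R
        using Z.backtracks_le[OF runD[OF that]] by (intro K(2)) (simp add: tlow)
      ultimately show ?case by blast
    qed
  qed

  have "\<exists>!x. is_arg_min F (\<lambda>_. True) x" unfolding F_def by (rule Z.ex1_minimizer)
  moreover have "\<tau> \<in> {0<..<1}" using \<tau>_bounds by simp
  moreover have "\<omega> > 0"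
    unfolding \<omega> using Z.\<theta>_bounds Lf m by (intro mult_pos_pos add_pos_pos) auto
  ultimately show ?thesis using part_i part_ii part_iii by blast
qed

end
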